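(* There exists a positive constant $C$ such that for infinitely many positive integers $n$ one has $\omega(n+k) \le \Omega(n+k) \le C\log k$ for every integer $k \ge 2$.
   Context: $\omega(m)=\sum_{p\mid m}1$ is the number of distinct prime factors of $m$, and $\Omega(m)=\sum_{p^j\mid m,\ j\ge1}1$ is the number of prime factors of $m$ counted with multiplicity. *)

theory Defs
  imports Complex_Main "HOL-Computational_Algebra.Primes"
begin

definition little_omega :: "nat \<Rightarrow> nat" where
  "little_omega m = (\<Sum>p | prime p \<and> p dvd m. 1)"

text \<open>
  The sum runs over all pairs \<open>(p, j)\<close> such that the prime power \<open>p ^ j\<close> divides \<open>m\<close>.
  Both index sets are finite for positive \<open>m\<close>; for \<open>m = 0\<close> they are infinite and both
  functions take the junk value 0.
\<close>

definition big_omega :: "nat \<Rightarrow> nat" where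
  "big_omega m = (\<Sum>(p, j) | prime p \<and> 1 \<le> j \<and> p ^ j dvd m. 1)"

lemma little_omega_eq_card_prime_factors:
  assumes "m > 0"
  shows "little_omega m = card (prime_factors m)"
proof -
  have "{p. prime p \<and> p dvd m} = prime_factors m"
    using assms by (auto simp: prime_factors_dvd)
  then show ?thesis
    by (simp add: little_omega_def)
qed

lemma big_omega_eq_size_prime_factorization:
  assumes "m > 0"
  shows "big_omega m = size (prime_factorization m)"
proof -
  have *: "{(p, j). prime p \<and> 1 \<le> j \<and> p ^ j dvd m} = 
      (SIGMA p:prime_factors m. {1..multiplicity p m})" (is "?A = ?B")
  proof (intro equalityI subsetI)
    fix x assume "x \<in> ?A"
    then obtain p j where x: "x = (p, j)" "prime p" "1 \<le> j" "p ^ j dvd m"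
      by auto
    have "p dvd m"
      using x(3,4) by (metis dvd_power dvd_trans not_one_le_zero gr0I)
    moreover have "j \<le> multiplicity p m"
      using x assms by (intro multiplicity_geI) auto
    ultimately show "x \<in> ?B"
      using x assms by (auto simp: prime_factors_dvd)
  next
    fix x assume "x \<in> ?B"
    then show "x \<in> ?A"
      by (auto simp: multiplicity_dvd')
  qed
  have "big_omega m = card ?A"
    by (simp add: big_omega_def)
  also have "\<dots> = (\<Sum>p\<in>prime_factors m. multiplicity p m)"
    unfolding * by (subst card_SigmaI) auto
  also have "\<dots> = size (prime_factorization m)"
    unfolding size_multiset_overloaded_eq
    by (intro sum.cong) (auto simp: count_prime_factorization_prime in_prime_factors_imp_prime)
  finally show ?thesis .
qed

end

theory Submission
  imports Defs "HOL-Number_Theory.Number_Theory"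
begin

text \<open>
  The numbers sought are \<open>n = W * (m + 1)\<close> with \<open>m < M = 2 ^ 4 ^ S\<close> and \<open>W\<close> the product of the
  primes below a slowly growing bound, so that \<open>n + k\<close> shares with \<open>k\<close> the small primes dividing it.
  The shift \<open>m\<close> is chosen by averaging against a nonnegative weight \<open>\<nu>\<close> of Brun type: the larger
  primes are split into blocks \<open>2 ^ 4 ^ s < p \<le> 2 ^ 4 ^ (s + 1)\<close>, each with bounded sum of
  reciprocals (Chebyshev), and \<open>\<nu>\<close> penalises a prime of block \<open>s\<close> that divides some \<open>n + l\<close> with
  \<open>1 \<le> l \<le> \<kappa> s = 2 ^ (S - s)\<close>. Since \<open>\<kappa> s\<close> is only the square root of the logarithmic length
  \<open>4 ^ (S - s)\<close>, truncating the inclusion-exclusion at order \<open>120 * \<kappa> s\<close> keeps the level of the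
  whole sieve below \<open>M\<close>.

  For given \<open>k\<close> only the \<open>O(log k)\<close> blocks with \<open>\<kappa> s < k\<close> are not sieved, so the \<open>\<nu>\<close>-average of
  \<open>(3 / 2) ^ \<Omega>(d)\<close> summed over the small divisors \<open>d\<close> of \<open>n + k\<close> is \<open>k ^ O(1)\<close>. A union bound over \<open>k\<close>
  with weights \<open>1 / k\<^sup>2\<close> then yields one \<open>m\<close> that is good for all \<open>k \<le> M\<close> simultaneously, and a number with
  many prime factors has a small divisor with a positive proportion of them. For \<open>k > M\<close> the
  trivial bound \<open>2 ^ \<Omega>(n + k) \<le> n + k\<close> suffices.
\<close>

subsection \<open>Averages of periodic functions\<close>

definition periodic :: "nat \<Rightarrow> (nat \<Rightarrow> 'a) \<Rightarrow> bool" where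
  "periodic q f \<longleftrightarrow> (\<forall>m. f (m + q) = f m)"

definition mean :: "nat \<Rightarrow> (nat \<Rightarrow> real) \<Rightarrow> real" where
  "mean Y f = (\<Sum>m<Y. f m) / real Y"

lemma periodic_add_mult:
  assumes "periodic q f" shows "f (m + q * j) = f m"
proof (induction j)
  case (Suc j)
  have "f (m + q * Suc j) = f ((m + q * j) + q)" by (simp add: algebra_simps)
  then show ?case using Suc assms by (simp add: periodic_def)
qed simp

lemma periodic_mod:
  assumes "periodic q f" shows "f (m mod q) = f m"
  using periodic_add_mult[OF assms, of "m mod q" "m div q"] by simp

lemma periodic_dvd:
  assumes "periodic q f" "q dvd r" shows "periodic r f"
  using assms periodic_add_mult[OF assms(1)] by (auto simp: periodic_def elim!: dvdE)

lemma periodic_prod: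
  assumes "\<And>i. i \<in> I \<Longrightarrow> periodic q (f i)"
  shows "periodic q (\<lambda>m. \<Prod>i\<in>I. f i m)"
  using assms by (simp add: periodic_def)

lemma periodic_mult:
  assumes "periodic q f" "periodic q g"
  shows "periodic q (\<lambda>m. f m * g m)"
  using assms by (simp add: periodic_def)

lemma periodic_dvd_linear:
  fixes a b q :: nat
  shows "periodic q (\<lambda>m. q dvd a * (m + 1) + b)"
proof -
  have "a * (m + q + 1) + b = (a * (m + 1) + b) + q * a" for m
    by (simp add: algebra_simps)
  then show ?thesis
    unfolding periodic_def by (metis dvd_add_left_iff dvd_triv_left)
qed

text \<open>Since \<open>a\<close> is invertible modulo \<open>b\<close>, the map \<open>j\<close>
  to \<open>i + a * j\<close> permutes the residues modulo \<open>b\<close>.\<close>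

lemma sum_periodic_linear:
  fixes g :: "nat \<Rightarrow> real"
  assumes "periodic b g" "coprime a b" "b > 0"
  shows "(\<Sum>j<b. g (i + a * j)) = (\<Sum>j<b. g j)"
proof -
  define h where "h = (\<lambda>j. (i + a * j) mod b)"
  have inj: "inj_on h {..<b}"
  proof (rule inj_onI)
    fix x y assume xy: "x \<in> {..<b}" "y \<in> {..<b}" "h x = h y"
    then have "[a * x = a * y] (mod b)"
      unfolding h_def cong_def[symmetric] by (simp add: cong_add_lcancel_nat)
    then have "[x = y] (mod b)" using assms(2) by (simp add: cong_mult_lcancel_nat)
    then show "x = y" using xy by (simp add: cong_def)
  qed
  moreover have "h ` {..<b} \<subseteq> {..<b}" using assms(3) by (auto simp: h_def)
  ultimately have img: "h ` {..<b} = {..<b}" by (simp add: endo_inj_surj)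
  have "(\<Sum>j<b. g j) = (\<Sum>j\<in>h ` {..<b}. g j)" by (simp add: img)
  also have "\<dots> = (\<Sum>j<b. g (h j))" using inj by (simp add: sum.reindex)
  finally show ?thesis using periodic_mod[OF assms(1)] by (simp add: h_def)
qed

lemma sum_lessThan_mult:
  fixes f :: "nat \<Rightarrow> real"
  shows "(\<Sum>m<a * b. f m) = (\<Sum>j<b. \<Sum>i<a. f (i + a * j))"
proof (induction b)
  case (Suc b)
  have "(\<Sum>m<a * Suc b. f m) = (\<Sum>m<a * b. f m) + (\<Sum>m\<in>{a * b..<a * b + a}. f m)"
    using sum.atLeastLessThan_concat[of 0 "a * b" "a * b + a" f]
    by (simp add: lessThan_atLeast0 add.commute)
  also have "(\<Sum>m\<in>{a * b..<a * b + a}. f m) = (\<Sum>i<a. f (i + a * b))"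
    using sum.shift_bounds_nat_ivl[of f 0 "a * b" a]
    by (simp add: lessThan_atLeast0 add.commute)
  finally show ?case using Suc by simp
qed simp

lemma mean_periodic:
  assumes "periodic a f" "a dvd Y" "Y > 0"
  shows "mean Y f = mean a f"
proof -
  obtain n where Y: "Y = a * n" using assms(2) by auto
  have "(\<Sum>m<Y. f m) = real n * (\<Sum>i<a. f i)"
    unfolding Y sum_lessThan_mult using periodic_add_mult[OF assms(1)] by simp
  then show ?thesis using assms(3) by (simp add: mean_def Y)
qed

text \<open>Independence via the Chinese remainder theorem: writing \<open>m = i + a * j\<close>,
  the value of \<open>f\<close> depends on \<open>i\<close> alone, while for fixed \<open>i\<close>
  the arguments of \<open>g\<close> run through all residues modulo \<open>b\<close>.\<close>

lemma mean_mult_coprime: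
  assumes "periodic a f" "periodic b g" "coprime a b" "a * b dvd Y" "Y > 0"
  shows "mean Y (\<lambda>m. f m * g m) = mean Y f * mean Y g"
proof -
  have pos: "a > 0" "b > 0" using assms(4,5) by (auto intro!: gr0I)
  have d: "a dvd Y" "b dvd Y" using assms(4) by (auto dest: dvd_mult_left dvd_mult_right)
  have "periodic (a * b) (\<lambda>m. f m * g m)"
    using assms periodic_dvd[of a f "a * b"] periodic_dvd[of b g "a * b"]
    by (intro periodic_mult) auto
  then have "mean Y (\<lambda>m. f m * g m) = (\<Sum>m<a * b. f m * g m) / real (a * b)"
    using assms mean_periodic[of "a * b"] by (simp add: mean_def)
  also have "(\<Sum>m<a * b. f m * g m) = (\<Sum>i<a. f i * (\<Sum>j<b. g (i + a * j)))"
    unfolding sum_lessThan_mult periodic_add_mult[OF assms(1)]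
    by (subst sum.swap) (simp add: sum_distrib_left)
  also have "\<dots> = (\<Sum>i<a. f i) * (\<Sum>j<b. g j)"
    using sum_periodic_linear[OF assms(2,3) pos(2)] by (simp add: sum_distrib_right)
  finally show ?thesis
    using mean_periodic[OF assms(1) d(1) assms(5)] mean_periodic[OF assms(2) d(2) assms(5)]
    by (simp add: mean_def)
qed

lemma mean_prod_coprime:
  fixes q :: "'a \<Rightarrow> nat"
  assumes "finite I" "\<And>i. i \<in> I \<Longrightarrow> periodic (q i) (f i)"
    "\<And>i j. i \<in> I \<Longrightarrow> j \<in> I \<Longrightarrow> i \<noteq> j \<Longrightarrow> coprime (q i) (q j)"
    "(\<Prod>i\<in>I. q i) dvd Y" "Y > 0"
  shows "mean Y (\<lambda>m. \<Prod>i\<in>I. f i m) = (\<Prod>i\<in>I. mean Y (f i))"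
  using assms
proof (induction I rule: finite_induct)
  case empty
  then show ?case by (simp add: mean_def)
next
  case (insert x I)
  have "periodic (\<Prod>i\<in>I. q i) (\<lambda>m. \<Prod>i\<in>I. f i m)"
    using insert.hyps insert.prems(1) by (intro periodic_prod periodic_dvd[OF insert.prems(1)]) auto
  moreover have "coprime (q x) (\<Prod>i\<in>I. q i)"
    using insert.hyps insert.prems(2) by (intro prod_coprime_right) auto
  moreover have "(\<Prod>i\<in>I. q i) dvd Y"
    using insert.prems(3) insert.hyps by (auto dest: dvd_mult_right)
  ultimately show ?case
    using insert mean_mult_coprime[of "q x" "f x" "\<Prod>i\<in>I. q i" "\<lambda>m. \<Prod>i\<in>I. f i m" Y] by simp
qed

lemma mean_mono:
  assumes "\<And>m. f m \<le> g m" shows "mean Y f \<le> mean Y g"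
  unfolding mean_def using assms by (intro divide_right_mono sum_mono) auto

lemma mean_nonneg:
  assumes "\<And>m. f m \<ge> 0" shows "mean Y f \<ge> 0"
  unfolding mean_def using assms by (intro divide_nonneg_nonneg sum_nonneg) auto

lemma mean_add: "mean Y (\<lambda>m. f m + g m) = mean Y f + mean Y g"
  by (simp add: mean_def sum.distrib add_divide_distrib)

lemma mean_diff: "mean Y (\<lambda>m. f m - g m) = mean Y f - mean Y g"
  by (simp add: mean_def sum_subtractf diff_divide_distrib)

lemma mean_cmult: "mean Y (\<lambda>m. c * f m) = c * mean Y f"
  by (simp add: mean_def sum_distrib_left)

lemma mean_const: "Y > 0 \<Longrightarrow> mean Y (\<lambda>m. c) = c"
  by (simp add: mean_def)

lemma mean_sum: "mean Y (\<lambda>m. \<Sum>i\<in>I. f i m) = (\<Sum>i\<in>I. mean Y (f i))"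
  by (simp add: mean_def sum_divide_distrib[symmetric] sum.swap[of _ I])

text \<open>As \<open>m\<close> runs through a period, \<open>a * (m + 1) + b\<close> meets each
  residue modulo \<open>q\<close> exactly once, the residue 0 included.\<close>

lemma mean_dvd_linear:
  fixes a b q Y :: nat
  assumes "coprime a q" "q dvd Y" "Y > 0"
  shows "mean Y (\<lambda>m. of_bool (q dvd a * (m + 1) + b)) = 1 / real q"
proof -
  have q: "q > 0" using assms by (auto intro!: gr0I)
  have per: "periodic q (\<lambda>x. of_bool (q dvd x) :: real)" by (simp add: periodic_def)
  have "mean Y (\<lambda>m. of_bool (q dvd a * (m + 1) + b)) = mean q (\<lambda>m. of_bool (q dvd a * (m + 1) + b))"
    using periodic_dvd_linear[of q a b] assms by (intro mean_periodic) (auto simp: periodic_def)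
  also have "\<dots> = (\<Sum>m<q. of_bool (q dvd (a + b) + a * m)) / real q"
    by (simp add: mean_def algebra_simps)
  also have "(\<Sum>m<q. of_bool (q dvd (a + b) + a * m) :: real) = (\<Sum>m<q. of_bool (q dvd m))"
    using sum_periodic_linear[OF per assms(1) q, of "a + b"] by simp
  also have "(\<Sum>m<q. of_bool (q dvd m) :: real) = (\<Sum>m<q. if m = 0 then 1 else 0)"
    by (intro sum.cong) (auto dest: dvd_imp_le)
  finally show ?thesis using q by simp
qed

text \<open>\<open>approximable Y f c\<close>: \<open>f\<close> is a linear combination of bounded functions whose periods divide \<open>Y\<close>,
  and \<open>c\<close> bounds the sum of the coefficients weighted by the periods. This controls the
  difference between the averages of \<open>f\<close> over a short interval and over a full period.\<close>

inductive approximable :: "nat \<Rightarrow> (nat \<Rightarrow> real) \<Rightarrow> real \<Rightarrow> bool" for Y where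
  base: "q dvd Y \<Longrightarrow> periodic q g \<Longrightarrow> (\<And>m. \<bar>g m\<bar> \<le> 1) \<Longrightarrow>
    approximable Y (\<lambda>m. c * g m) (\<bar>c\<bar> * real q)"
| add: "approximable Y f a \<Longrightarrow> approximable Y g b \<Longrightarrow> approximable Y (\<lambda>m. f m + g m) (a + b)"
| mono: "approximable Y f a \<Longrightarrow> a \<le> b \<Longrightarrow> approximable Y f b"

lemma approximable_nonneg: "approximable Y f a \<Longrightarrow> a \<ge> 0"
  by (induction rule: approximable.induct) auto

text \<open>Two terms with periods \<open>q\<close> and \<open>r\<close> multiply to one with period
  \<open>lcm q r\<close>. The lcm still divides \<open>Y\<close>, which \<open>q * r\<close> need
  not do, and it is at most \<open>q * r\<close>, so costs multiply.\<close>

lemma approximable_mult: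
  assumes "approximable Y f a" "approximable Y g b"
  shows "approximable Y (\<lambda>m. f m * g m) (a * b)"
  using assms(1)
proof (induction rule: approximable.induct)
  case (base q f c)
  note f = base
  from assms(2) show ?case
  proof (induction rule: approximable.induct)
    case (base r g d)
    have "lcm q r \<le> q * r"
      using dvd_imp_le[of "lcm q r" "q * r"] by (cases "q * r = 0") (auto intro: lcm_least)
    then have le: "\<bar>c * d\<bar> * real (lcm q r) \<le> \<bar>c\<bar> * real q * (\<bar>d\<bar> * real r)"
      unfolding abs_mult by (metis (no_types, opaque_lifting) abs_ge_zero mult.assoc mult.left_commute mult_left_mono of_nat_le_iff of_nat_mult zero_le_mult_iff)
    have "approximable Y (\<lambda>m. (c * d) * (f m * g m)) (\<bar>c * d\<bar> * real (lcm q r))"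
      using f base
      by (intro approximable.base periodic_mult) (auto intro: periodic_dvd simp: abs_mult mult_le_one)
    from approximable.mono[OF this le] show ?case by (simp add: mult_ac)
  next
    case (add g1 a1 g2 a2)
    then show ?case using approximable.add[OF add.IH] by (simp add: algebra_simps)
  next
    case (mono g a1 b1)
    show ?case by (rule approximable.mono[OF mono.IH]) (use mono in \<open>auto intro: mult_left_mono\<close>)
  qed
next
  case (add f1 a1 f2 a2)
  then show ?case using approximable.add[OF add.IH] by (simp add: algebra_simps)
next
  case (mono f a1 b1)
  show ?case
    by (rule approximable.mono[OF mono.IH])
      (use mono approximable_nonneg[OF assms(2)] in \<open>auto intro: mult_right_mono\<close>)
qed

lemma approximable_const: "approximable Y (\<lambda>m. c) \<bar>c\<bar>"
  using approximable.base[of 1 Y "\<lambda>_. 1" c] by (simp add: periodic_def)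

lemma approximable_sum:
  assumes "finite I" "\<And>i. i \<in> I \<Longrightarrow> approximable Y (f i) (a i)"
  shows "approximable Y (\<lambda>m. \<Sum>i\<in>I. f i m) (\<Sum>i\<in>I. a i)"
  using assms
proof (induction I rule: finite_induct)
  case empty
  then show ?case using approximable_const[of Y 0] by simp
next
  case (insert x I)
  then show ?case using approximable.add[of Y "f x" "a x" "\<lambda>m. \<Sum>i\<in>I. f i m" "\<Sum>i\<in>I. a i"] by simp
qed

lemma approximable_prod:
  assumes "finite I" "\<And>i. i \<in> I \<Longrightarrow> approximable Y (f i) (a i)"
  shows "approximable Y (\<lambda>m. \<Prod>i\<in>I. f i m) (\<Prod>i\<in>I. a i)"
  using assms
proof (induction I rule: finite_induct)
  case empty
  then show ?case using approximable_const[of Y 1] by simp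
next
  case (insert x I)
  then show ?case
    using approximable_mult[of Y "f x" "a x" "\<lambda>m. \<Prod>i\<in>I. f i m" "\<Prod>i\<in>I. a i"] by simp
qed

text \<open>Complete periods contribute exactly; the incomplete last one and its expected share are
  each at most \<open>q\<close> in absolute value.\<close>

lemma sum_periodic_interval:
  assumes "periodic q g" "q > 0" "\<And>m. \<bar>g m\<bar> \<le> (1::real)"
  shows "\<bar>(\<Sum>m<X. g m) - real X * mean q g\<bar> \<le> 2 * real q"
proof -
  define r h where "r = X mod q" and "h = X div q"
  have X: "X = q * h + r" by (simp add: r_def h_def)
  have "(\<Sum>m<X. g m) = (\<Sum>m<q * h. g m) + (\<Sum>m\<in>{q * h..<q * h + r}. g m)"
    unfolding X using sum.atLeastLessThan_concat[of 0 "q * h" "q * h + r" g]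
    by (simp add: lessThan_atLeast0)
  also have "(\<Sum>m<q * h. g m) = real (q * h) * mean q g"
    unfolding sum_lessThan_mult periodic_add_mult[OF assms(1)] using assms(2) by (simp add: mean_def)
  finally have eq: "(\<Sum>m<X. g m) - real X * mean q g
      = (\<Sum>m\<in>{q * h..<q * h + r}. g m) - real r * mean q g"
    unfolding X by (simp add: algebra_simps)
  have "\<bar>\<Sum>m\<in>{q * h..<q * h + r}. g m\<bar> \<le> (\<Sum>m\<in>{q * h..<q * h + r}. 1)"
    using assms(3) by (intro order.trans[OF sum_abs] sum_mono) auto
  then have 1: "\<bar>\<Sum>m\<in>{q * h..<q * h + r}. g m\<bar> \<le> real r" by simp
  have "\<bar>\<Sum>m<q. g m\<bar> \<le> (\<Sum>m<q. 1)"
    using assms(3) by (intro order.trans[OF sum_abs] sum_mono) auto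
  then have "\<bar>mean q g\<bar> \<le> 1" using assms(2) by (simp add: mean_def field_simps)
  then have 2: "\<bar>real r * mean q g\<bar> \<le> real r" by (simp add: abs_mult mult_left_le)
  have "real r \<le> real q" using assms(2) by (simp add: r_def less_imp_le)
  then show ?thesis using 1 2 unfolding eq by linarith
qed

text \<open>The error depends on the cost \<open>a\<close> and on \<open>X\<close>, but not on
  \<open>Y\<close>, so the common period may be as large as convenient.\<close>

lemma approximable_mean:
  assumes "approximable Y f a" "Y > 0" "X > 0"
  shows "\<bar>mean X f - mean Y f\<bar> \<le> 2 * a / real X"
  using assms(1)
proof (induction rule: approximable.induct)
  case (base q g c)
  have q: "q > 0" using base(1) assms(2) by (auto intro!: gr0I)
  have "\<bar>(\<Sum>m<X. g m) - real X * mean Y g\<bar> \<le> 2 * real q"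
    using sum_periodic_interval[OF base(2) q base(3)] mean_periodic[OF base(2,1) assms(2)] by simp
  then have "\<bar>mean X g - mean Y g\<bar> \<le> 2 * real q / real X"
    using assms(3) by (simp add: mean_def abs_le_iff field_simps)
  then have "\<bar>c\<bar> * \<bar>mean X g - mean Y g\<bar> \<le> \<bar>c\<bar> * (2 * real q / real X)"
    by (intro mult_left_mono) auto
  then show ?case by (simp add: mean_cmult abs_mult[symmetric] algebra_simps)
next
  case (add f a g b)
  then show ?case by (simp add: mean_add add_divide_distrib algebra_simps)
next
  case (mono f a b)
  have "2 * a / real X \<le> 2 * b / real X" using mono assms by (intro divide_right_mono) auto
  then show ?case using mono by linarith
qed

subsection \<open>Primes and divisors\<close>

lemma prod_primes_dvd:
  fixes n :: nat
  assumes "finite A" "\<And>p. p \<in> A \<Longrightarrow> prime p" "\<And>p. p \<in> A \<Longrightarrow> p dvd n"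
  shows "\<Prod>A dvd n"
  using assms
proof (induction A rule: finite_induct)
  case (insert p A)
  have "coprime p (\<Prod>A)"
    using insert by (intro prod_coprime_right) (metis insertCI primes_coprime)
  then show ?case using insert by (simp add: divides_mult)
qed simp

section \<open>Chebyshev bounds for reciprocals of primes\<close>

text \<open>With \<open>n = 2 ^ i\<close>, every prime in \<open>(n, 2 * n]\<close> divides the
  central binomial coefficient, which is at most \<open>2 ^ (2 * n)\<close>. Each such prime exceeds
  \<open>n\<close>, so there are at most \<open>2 * n / i\<close> of them.\<close>

lemma sum_inverse_primes_dyadic:
  fixes i :: nat
  assumes "i > 0"
  shows "(\<Sum>p | prime p \<and> 2 ^ i < p \<and> p \<le> 2 ^ Suc i. 1 / real p) \<le> 2 / real i"
proof -
  define n :: nat where "n = 2 ^ i"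
  define A where "A = {p. prime p \<and> n < p \<and> p \<le> 2 * n}"
  have fin: "finite A" by (rule finite_subset[of _ "{..2 * n}"]) (auto simp: A_def)
  have "p dvd (2 * n choose n)" if "p \<in> A" for p
  proof -
    have p: "prime p" "n < p" "p \<le> 2 * n" using that by (auto simp: A_def)
    have "p dvd fact (2 * n)" using p by (simp add: prime_dvd_fact_iff)
    moreover have "fact (2 * n) = fact n * fact n * (2 * n choose n)"
      using binomial_fact_lemma[of n "2 * n"] by simp
    moreover have "\<not> p dvd fact n" using p by (simp add: prime_dvd_fact_iff)
    ultimately show ?thesis using p(1) by (metis prime_dvd_mult_iff)
  qed
  then have "\<Prod>A dvd (2 * n choose n)"
    using fin by (intro prod_primes_dvd) (auto simp: A_def)
  then have "\<Prod>A \<le> (2 * n choose n)" by (rule dvd_imp_le) simp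
  also have "\<dots> \<le> 2 ^ (2 * n)" by (rule binomial_le_pow2)
  finally have "\<Prod>A \<le> 2 ^ (2 * n)" .
  moreover have "n ^ card A \<le> \<Prod>A"
  proof -
    have "(\<Prod>p\<in>A. n) \<le> \<Prod>A" by (intro prod_mono) (auto simp: A_def)
    then show ?thesis by simp
  qed
  ultimately have "(2::nat) ^ (i * card A) \<le> 2 ^ (2 * n)"
    by (simp add: n_def power_mult)
  then have "i * card A \<le> 2 * n" by (simp add: power_increasing_iff)
  then have card: "real i * real (card A) \<le> 2 * real n"
    by (metis of_nat_le_iff of_nat_mult of_nat_numeral)
  have "(\<Sum>p\<in>A. 1 / real p) \<le> (\<Sum>p\<in>A. 1 / real n)"
    by (intro sum_mono frac_le) (auto simp: A_def n_def)
  also have "\<dots> \<le> 2 / real i"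
    using card assms by (simp add: n_def field_simps)
  finally show ?thesis by (simp add: A_def n_def)
qed

lemma sum_inverse_primes_doubling:
  fixes a b :: nat
  assumes "a > 0" "a \<le> b"
  shows "(\<Sum>p | prime p \<and> 2 ^ a < p \<and> p \<le> 2 ^ b. 1 / real p) \<le> (\<Sum>i\<in>{a..<b}. 2 / real i)"
  using assms(2)
proof (induction b rule: dec_induct)
  case base
  have "{p::nat. prime p \<and> 2 ^ a < p \<and> p \<le> 2 ^ a} = {}" by auto
  then show ?case by (simp only: sum.empty) simp
next
  case (step b)
  have le: "(2::nat) ^ a \<le> 2 ^ b" using step by (intro power_increasing) auto
  have lt: "2 ^ a < p" if "2 ^ b < p" for p :: nat using le that by linarith
  have eq: "{p::nat. prime p \<and> 2 ^ a < p \<and> p \<le> 2 ^ Suc b} =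
      {p. prime p \<and> 2 ^ a < p \<and> p \<le> 2 ^ b} \<union> {p. prime p \<and> 2 ^ b < p \<and> p \<le> 2 ^ Suc b}"
    using lt by auto
  have "(\<Sum>p | prime p \<and> 2 ^ a < p \<and> p \<le> 2 ^ Suc b. 1 / real p) =
      (\<Sum>p | prime p \<and> 2 ^ a < p \<and> p \<le> 2 ^ b. 1 / real p) +
      (\<Sum>p | prime p \<and> 2 ^ b < p \<and> p \<le> 2 ^ Suc b. 1 / real p)"
    unfolding eq by (rule sum.union_disjoint) auto
  then show ?case
    using step sum_inverse_primes_dyadic[of b] assms(1) by simp
qed

lemma sum_inverse_doubling:
  assumes "a > 0"
  shows "(\<Sum>i\<in>{a..<2 * a}. 2 / real i) \<le> 2"
proof -
  have "(\<Sum>i\<in>{a..<2 * a}. 2 / real i) \<le> (\<Sum>i\<in>{a..<2 * a}. 2 / real a)"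
    using assms by (intro sum_mono frac_le) auto
  then show ?thesis using assms by simp
qed

text \<open>The dyadic exponents from \<open>a\<close> to \<open>4 * a\<close> form two doubling
  ranges, each contributing at most 2.\<close>

lemma sum_inverse_primes_quadrupling:
  fixes a :: nat
  assumes "a > 0"
  shows "(\<Sum>p | prime p \<and> 2 ^ a < p \<and> p \<le> 2 ^ (4 * a). 1 / real p) \<le> 4"
proof -
  have "(\<Sum>i\<in>{a..<4 * a}. 2 / real i) =
      (\<Sum>i\<in>{a..<2 * a}. 2 / real i) + (\<Sum>i\<in>{2 * a..<2 * (2 * a)}. 2 / real i)"
    using sum.atLeastLessThan_concat[of a "2 * a" "4 * a" "\<lambda>i. 2 / real i"] by simp
  then show ?thesis
    using sum_inverse_primes_doubling[OF assms, of "4 * a"] sum_inverse_doubling[OF assms]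
      sum_inverse_doubling[of "2 * a"] assms by simp
qed

section \<open>Small divisors with many prime factors\<close>

lemma ex_divisor_size:
  fixes n r :: nat
  assumes "n > 0" "r \<le> size (prime_factorization n)"
  shows "\<exists>d. d dvd n \<and> size (prime_factorization d) = r"
proof -
  obtain M where M: "M \<subseteq># prime_factorization n" "size M = r"
  proof -
    obtain xs where xs: "mset xs = prime_factorization n" using ex_mset by blast
    have "mset (take r xs) + mset (drop r xs) = prime_factorization n"
      by (metis append_take_drop_id mset_append xs)
    then have "mset (take r xs) \<subseteq># prime_factorization n" by (metis mset_subset_eq_add_left)
    moreover have "size (mset (take r xs)) = r"
      using assms(2) by (simp add: size_mset flip: xs)
    ultimately show ?thesis using that by blast
  qed
  have pf: "prime_factorization (\<Prod>\<^sub># M) = M"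
    using M(1) by (intro prime_factorization_prod_mset_primes) (auto dest: mset_subset_eqD)
  have "\<Prod>\<^sub># M dvd \<Prod>\<^sub># (prime_factorization n)"
    using M(1) by (rule prod_mset_subset_imp_dvd)
  then have "\<Prod>\<^sub># M dvd n" using assms(1) by (simp add: prod_mset_prime_factorization_weak)
  then show ?thesis using pf M(2) by metis
qed

text \<open>A number with many prime factors has a small divisor with a positive proportion of them:
  among \<open>H\<close> complementary divisors with \<open>r\<close> prime factors each, take the least.\<close>

lemma ex_small_divisor_size:
  fixes n H r :: nat
  assumes "n > 0" "H > 0" "H * r \<le> size (prime_factorization n)"
  shows "\<exists>d. d dvd n \<and> size (prime_factorization d) = r \<and> d ^ H \<le> n"
  using assms(2,1,3)
proof (induction H arbitrary: n rule: nat_induct_non_zero)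
  case 1
  then obtain d where "d dvd n" "size (prime_factorization d) = r"
    using ex_divisor_size[of n r] by auto
  then show ?case using 1 by (auto intro!: exI[of _ d] dvd_imp_le)
next
  case (Suc H)
  obtain e where e: "e dvd n" "size (prime_factorization e) = r"
    using ex_divisor_size[of n r] Suc by auto
  then obtain m where n: "n = e * m" by auto
  then have pos: "e > 0" "m > 0" using Suc by auto
  have "prime_factorization n = prime_factorization e + prime_factorization m"
    using pos by (simp add: n prime_factorization_mult)
  then have "H * r \<le> size (prime_factorization m)" using Suc e by simp
  then obtain d where d: "d dvd m" "size (prime_factorization d) = r" "d ^ H \<le> m"
    using Suc.IH[OF pos(2)] by auto
  show ?case
  proof (cases "d \<le> e")
    case True
    then have "d ^ Suc H \<le> n" using mult_le_mono[OF True d(3)] by (simp add: n)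
    then show ?thesis using d by (intro exI[of _ d]) (simp add: n)
  next
    case False
    then have "e ^ H \<le> d ^ H" by (intro power_mono) auto
    then have "e ^ Suc H \<le> n" using d(3) by (simp add: n)
    then show ?thesis using e by (intro exI[of _ e]) simp
  qed
qed

section \<open>Weighted divisor sums and their local factors\<close>

text \<open>The Euler factor at \<open>p\<close> of the sum of \<open>(3 / 2) ^ \<Omega>(d)\<close>
  over divisors \<open>d\<close>. Truncation at \<open>E\<close> gives it the period
  \<open>p ^ E\<close>; the base lies below 2 so that the mean converges geometrically even at
  \<open>p = 2\<close>.\<close>

definition power_count :: "nat \<Rightarrow> nat \<Rightarrow> nat \<Rightarrow> real" where
  "power_count E p x = (\<Sum>i\<le>E. (3 / 2) ^ i * of_bool (p ^ i dvd x))"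

lemma power_count_ge_1: "power_count E p x \<ge> 1"
proof -
  have "(\<Sum>i\<in>{0}. (3 / 2) ^ i * of_bool (p ^ i dvd x)) \<le> power_count E p x"
    unfolding power_count_def by (intro sum_mono2) auto
  then show ?thesis by simp
qed

lemma power_count_eq_1:
  assumes "\<not> p dvd x"
  shows "power_count E p x = 1"
proof -
  have "p ^ i dvd x \<longleftrightarrow> i = 0" for i
    using assms by (metis dvd_power dvd_trans gr0I one_dvd power_0)
  then have "power_count E p x = (\<Sum>i\<le>E. if i = 0 then 1 else 0)"
    unfolding power_count_def by (intro sum.cong) auto
  then show ?thesis by simp
qed

lemma periodic_power_count: "periodic (p ^ E) (\<lambda>m. power_count E p (W * (m + 1) + k))"
proof -
  have "periodic (p ^ E) (\<lambda>m. p ^ i dvd W * (m + 1) + k)" if "i \<le> E" for i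
    using that by (intro periodic_dvd[OF periodic_dvd_linear] le_imp_power_dvd)
  then have "(p ^ i dvd W * (m + p ^ E + 1) + k) = (p ^ i dvd W * (m + 1) + k)" if "i \<le> E" for i m
    using that unfolding periodic_def by blast
  then show ?thesis
    unfolding periodic_def power_count_def by (intro allI sum.cong refl) (simp only: atMost_iff)
qed

lemma sum_geometric_le:
  fixes r :: real
  assumes "0 \<le> r" "r \<le> 1 / 2"
  shows "(\<Sum>i<n. r ^ Suc i) \<le> 2 * r"
proof (induction n)
  case (Suc n)
  have "(\<Sum>i<Suc n. r ^ Suc i) = r + r * (\<Sum>i<n. r ^ Suc i)"
    by (subst sum.lessThan_Suc_shift) (simp add: sum_distrib_left)
  also have "\<dots> \<le> r + r * (2 * r)" using Suc assms by (intro add_left_mono mult_left_mono) auto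
  also have "\<dots> = r + 2 * r * r" by simp
  also have "2 * r * r \<le> 1 * r" using assms by (intro mult_right_mono) auto
  finally show ?case by simp
qed (use assms in simp)

text \<open>The power \<open>p ^ i\<close> divides with density \<open>p ^ (-i)\<close>, giving a
  geometric series of ratio \<open>3 / (2 * p)\<close>, which is at most 1/2 because
  \<open>p \<ge> 3\<close>.\<close>

lemma mean_power_count:
  assumes "prime p" "p \<ge> 3" "coprime W p" "p ^ E dvd Y" "Y > 0"
  shows "mean Y (\<lambda>m. power_count E p (W * (m + 1) + k)) \<le> 1 + 3 / real p"
proof -
  have r: "3 / (2 * real p) \<le> 1 / 2" using assms by simp
  have "mean Y (\<lambda>m. power_count E p (W * (m + 1) + k)) =
      (\<Sum>i\<le>E. (3 / 2) ^ i * mean Y (\<lambda>m. of_bool (p ^ i dvd W * (m + 1) + k)))"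
    unfolding power_count_def mean_sum mean_cmult ..
  also have "\<dots> = (\<Sum>i\<le>E. (3 / (2 * real p)) ^ i)"
  proof (intro sum.cong refl)
    fix i assume "i \<in> {..E}"
    then have "p ^ i dvd Y" using assms(4) by (metis atMost_iff dvd_trans le_imp_power_dvd)
    then have "mean Y (\<lambda>m. of_bool (p ^ i dvd W * (m + 1) + k)) = 1 / real (p ^ i)"
      using assms by (intro mean_dvd_linear) auto
    then show "(3 / 2) ^ i * mean Y (\<lambda>m. of_bool (p ^ i dvd W * (m + 1) + k)) = (3 / (2 * real p)) ^ i"
      by (simp add: power_divide power_mult_distrib)
  qed
  also have "\<dots> = 1 + (\<Sum>i<E. (3 / (2 * real p)) ^ Suc i)"
    by (subst lessThan_Suc_atMost[symmetric], subst sum.lessThan_Suc_shift) simp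
  also have "\<dots> \<le> 1 + 2 * (3 / (2 * real p))"
    using sum_geometric_le[OF _ r] by simp
  finally show ?thesis by simp
qed

text \<open>For \<open>p\<close> dividing both \<open>W\<close> and \<open>k\<close>, one power of \<open>p\<close> is forced and the others occur with
  their natural density.\<close>

lemma mean_power_count_common:
  assumes "prime p" "coprime W' p" "p ^ E dvd Y" "Y > 0" "p dvd k"
  shows "mean Y (\<lambda>m. power_count E p (p * W' * (m + 1) + k)) \<le> 8"
proof -
  obtain k' where k: "k = p * k'" using assms by auto
  have p2: "real p \<ge> 2" using prime_ge_2_nat[OF assms(1)] by simp
  have mi: "mean Y (\<lambda>m. of_bool (p ^ Suc i dvd p * W' * (m + 1) + k)) \<le> (1 / 2) ^ i" if "i \<le> E" for i
  proof -
    have "p ^ Suc i dvd p * W' * (m + 1) + k \<longleftrightarrow> p ^ i dvd W' * (m + 1) + k'" for m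
    proof -
      have "p * W' * (m + 1) + k = p * (W' * (m + 1) + k')" by (simp add: k algebra_simps)
      then show ?thesis using p2 by (simp del: mult_Suc_right)
    qed
    moreover have "p ^ i dvd Y" using assms(3) that by (metis dvd_trans le_imp_power_dvd)
    ultimately have "mean Y (\<lambda>m. of_bool (p ^ Suc i dvd p * W' * (m + 1) + k)) = 1 / real (p ^ i)"
      using assms by (simp only:) (intro mean_dvd_linear, auto)
    also have "\<dots> = (1 / real p) ^ i" by (simp add: power_divide)
    also have "\<dots> \<le> (1 / 2) ^ i" using p2 by (intro power_mono) (auto simp: field_simps)
    finally show ?thesis .
  qed
  have "mean Y (\<lambda>m. power_count E p (p * W' * (m + 1) + k)) =
      (\<Sum>i\<le>E. (3 / 2) ^ i * mean Y (\<lambda>m. of_bool (p ^ i dvd p * W' * (m + 1) + k)))"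
    unfolding power_count_def mean_sum mean_cmult ..
  also have "\<dots> = 1 + (\<Sum>i<E. (3 / 2) ^ Suc i * mean Y (\<lambda>m. of_bool (p ^ Suc i dvd p * W' * (m + 1) + k)))"
    using assms(4)
    by (subst lessThan_Suc_atMost[symmetric], subst sum.lessThan_Suc_shift) (simp add: mean_const)
  also have "\<dots> \<le> 1 + (\<Sum>i<E. (3 / 2) ^ Suc i * (1 / 2) ^ i)"
    using mi by (intro add_left_mono sum_mono mult_left_mono) auto
  also have "(\<Sum>i<E. (3 / 2) ^ Suc i * (1 / 2) ^ i) = 3 / 2 * (\<Sum>i<E. (3 / 4 :: real) ^ i)"
  proof -
    have "(3 / 2 :: real) ^ i * (1 / 2) ^ i = (3 / 4) ^ i" for i
      by (subst power_mult_distrib[symmetric]) simp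
    then have "(3 / 2 :: real) ^ Suc i * (1 / 2) ^ i = 3 / 2 * (3 / 4) ^ i" for i
      by simp
    then show ?thesis by (simp only: sum_distrib_left)
  qed
  also have "(\<Sum>i<E. (3 / 4 :: real) ^ i) = 4 * (1 - (3 / 4) ^ E)"
    by (subst sum_gp_strict) simp
  \<comment> \<open>The sum is at most 7; the cube 8 is more convenient, since a factor
    \<open>2 ^ 3\<close> for each prime divisor of \<open>k\<close> multiplies to at most
    \<open>k ^ 3\<close>.\<close>
  also have "1 + 3 / 2 * (4 * (1 - (3 / 4 :: real) ^ E)) \<le> 8"
    by (rule order.trans[of _ 7]) simp_all
  finally show ?thesis by simp
qed

text \<open>The restriction \<open>d \<le> z\<close> keeps all periods small, so that averages over
  a short interval remain under control.\<close>

definition weighted_divisors :: "nat \<Rightarrow> nat \<Rightarrow> real" where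
  "weighted_divisors z x =
    (\<Sum>d\<in>{1..z}. (3 / 2) ^ size (prime_factorization d) * of_bool (d dvd x))"

text \<open>Expanding the Euler product gives one nonnegative term for each exponent vector with
  entries up to \<open>z\<close>. Distinct \<open>d \<le> z\<close> have distinct vectors, so the
  divisor sum is dominated by part of the expansion.\<close>

lemma weighted_divisors_le:
  "weighted_divisors z x \<le> (\<Prod>p | prime p \<and> p \<le> z. power_count z p x)"
proof -
  define P where "P = {p::nat. prime p \<and> p \<le> z}"
  have fin: "finite P" by (rule finite_subset[of _ "{..z}"]) (auto simp: P_def)
  \<comment> \<open>The exponent vector of \<open>d\<close>; \<open>restrict\<close> makes it
    extensional, as membership in \<open>PiE\<close> demands.\<close>
  define h where "h = (\<lambda>d. restrict (\<lambda>p. multiplicity p d) P)"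
  define g where "g = (\<lambda>v. \<Prod>p\<in>P. (3 / 2 :: real) ^ v p * of_bool (p ^ v p dvd x))"
  have pf: "prime_factors d \<subseteq> P" if "d \<in> {1..z}" for d
    using that by (auto simp: P_def in_prime_factors_iff dest!: dvd_imp_le)
  have inj: "inj_on h {1..z}"
  proof (rule inj_onI)
    fix d e assume de: "d \<in> {1..z}" "e \<in> {1..z}" "h d = h e"
    have "multiplicity p d = multiplicity p e" if "prime p" for p
    proof (cases "p \<in> P")
      case True
      have "h d p = h e p" using de(3) by simp
      then show ?thesis using True by (simp add: h_def)
    next
      case False
      then have "p \<notin> prime_factors d" "p \<notin> prime_factors e" using pf de by auto
      then have "\<not> p dvd d" "\<not> p dvd e" using that de by (auto simp: in_prime_factors_iff)
      then show ?thesis by (simp add: not_dvd_imp_multiplicity_0)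
    qed
    then show "d = e"
      by (rule multiplicity_eq_nat[rotated 2]) (use de(1,2) in simp_all)
  qed
  have sub: "h ` {1..z} \<subseteq> PiE P (\<lambda>_. {..z})"
  proof
    fix v assume "v \<in> h ` {1..z}"
    then obtain d where d: "d \<in> {1..z}" "v = h d" by auto
    have "multiplicity p d \<le> z" if "p \<in> P" for p
    proof -
      \<comment> \<open>An exponent is smaller than the prime power it produces, so truncating
        exponents at \<open>z\<close> loses no \<open>d \<le> z\<close>.\<close>
      have "multiplicity p d < p ^ multiplicity p d"
        using that prime_ge_2_nat by (intro power_gt_expt) (auto simp: P_def dest: prime_gt_1_nat)
      also have "\<dots> \<le> d" using d multiplicity_dvd[of p d] by (intro dvd_imp_le) auto
      finally show ?thesis using d by simp
    qed
    then show "v \<in> PiE P (\<lambda>_. {..z})" using d by (auto simp: h_def)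
  qed
  have "weighted_divisors z x \<le> (\<Sum>d\<in>{1..z}. g (h d))"
    unfolding weighted_divisors_def
  proof (intro sum_mono)
    fix d assume d: "d \<in> {1..z}"
    have "size (prime_factorization d) = (\<Sum>p\<in>P. multiplicity p d)"
    proof -
      have "size (prime_factorization d) = (\<Sum>p\<in>prime_factors d. multiplicity p d)"
        unfolding size_multiset_overloaded_eq
        by (intro sum.cong) (auto simp: count_prime_factorization_prime in_prime_factors_imp_prime)
      also have "\<dots> = (\<Sum>p\<in>P. multiplicity p d)"
        using fin pf[OF d] d
        by (intro sum.mono_neutral_left) (auto simp: in_prime_factors_iff P_def not_dvd_imp_multiplicity_0)
      finally show ?thesis .
    qed
    then have "(3 / 2 :: real) ^ size (prime_factorization d) = (\<Prod>p\<in>P. (3 / 2) ^ multiplicity p d)"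
      by (simp add: power_sum)
    moreover have "d dvd x \<Longrightarrow> p ^ multiplicity p d dvd x" for p
      using multiplicity_dvd dvd_trans by blast
    ultimately show "(3 / 2) ^ size (prime_factorization d) * of_bool (d dvd x) \<le> g (h d)"
      unfolding g_def h_def by (auto intro: prod_nonneg)
  qed
  also have "\<dots> = (\<Sum>v\<in>h ` {1..z}. g v)" using inj by (simp add: sum.reindex)
  also have "\<dots> \<le> (\<Sum>v\<in>PiE P (\<lambda>_. {..z}). g v)"
    using sub fin by (intro sum_mono2 finite_PiE) (auto simp: g_def intro!: prod_nonneg)
  also have "\<dots> = (\<Prod>p\<in>P. power_count z p x)"
    unfolding g_def power_count_def using fin by (subst prod_sum_PiE) auto
  finally show ?thesis by (simp add: P_def)
qed

subsection \<open>Brun weights on one block of primes\<close>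

text \<open>For even \<open>D\<close> this equals the inclusion-exclusion sum for \<open>[N = 0]\<close>
  truncated after \<open>D\<close> terms; unlike the latter it is visibly of low degree in \<open>N\<close>.\<close>

definition brun :: "nat \<Rightarrow> nat \<Rightarrow> real" where
  "brun D N = (\<Prod>l\<in>{1..D}. 1 - real N / real l)"

lemma brun_0 [simp]: "brun D 0 = 1"
  by (simp add: brun_def)

lemma brun_eq_0:
  assumes "0 < N" "N \<le> D" shows "brun D N = 0"
  unfolding brun_def using assms by (intro prod_zero) (auto intro!: bexI[of _ N])

text \<open>All \<open>D\<close> factors are negative, and evenness of \<open>D\<close> cancels the
  signs.\<close>

lemma brun_eq_binomial:
  assumes "even D" "D < N"
  shows "brun D N = real ((N - 1) choose D)"
proof -
  have "brun D N = (\<Prod>l\<in>{1..D}. (-1) * ((real N - real l) / real l))"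
    unfolding brun_def by (intro prod.cong) (auto simp: field_simps)
  also have "\<dots> = (\<Prod>l\<in>{1..D}. (real N - real l) / real l)"
    unfolding prod.distrib using assms(1) by simp
  also have "\<dots> = (\<Prod>l\<in>{1..D}. real N - real l) / fact D"
    by (simp add: prod_dividef fact_prod)
  also have "(\<Prod>l\<in>{1..D}. real N - real l) = (\<Prod>i\<in>{0..<D}. real (N - 1) - real i)"
    using assms(2) by (intro prod.reindex_bij_witness[of _ Suc "\<lambda>l. l - 1"]) (auto simp: of_nat_diff)
  finally show ?thesis by (simp add: binomial_gbinomial gbinomial_prod_rev)
qed

lemma brun_nonneg:
  assumes "even D" shows "brun D N \<ge> 0"
  using brun_eq_0[of N D] brun_eq_binomial[OF assms, of N]
  by (cases "N = 0"; cases "N \<le> D") auto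

text \<open>For \<open>N > D\<close> the term \<open>(N choose D) * 2 ^ D\<close> is one summand of
  \<open>(2 + 1) ^ N\<close>. The bound has this shape because \<open>3 ^ N\<close> factors over the
  primes counted by \<open>N\<close>, so its mean can be computed.\<close>

lemma brun_le:
  assumes "even D" shows "brun D N \<le> of_bool (N = 0) + 3 ^ N / 2 ^ D"
proof (cases "D < N")
  case True
  have "(N choose D) * 2 ^ D \<le> (\<Sum>k\<le>N. (N choose k) * 2 ^ k)"
    using True by (intro member_le_sum[of D]) auto
  also have "\<dots> = (2 + 1) ^ N" by (subst binomial_ring) simp
  finally have "real ((N choose D) * 2 ^ D) \<le> real (3 ^ N)"
    by (subst of_nat_le_iff) simp
  then have "real (N choose D) * 2 ^ D \<le> 3 ^ N" by simp
  moreover have "real ((N - 1) choose D) \<le> real (N choose D)"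
    by (simp add: binomial_right_mono)
  ultimately have "real ((N - 1) choose D) * 2 ^ D \<le> 3 ^ N"
    by (meson mult_right_mono order.trans zero_le_numeral zero_le_power)
  then show ?thesis using True brun_eq_binomial[OF assms True] by (simp add: field_simps)
next
  case False
  then show ?thesis using brun_eq_0[of N D] by (cases "N = 0") auto
qed

definition hits :: "nat \<Rightarrow> nat \<Rightarrow> nat \<Rightarrow> nat \<Rightarrow> bool" where
  "hits W \<kappa> p m \<longleftrightarrow> (\<exists>l\<in>{1..\<kappa>}. p dvd W * (m + 1) + l)"

definition hit_count :: "nat \<Rightarrow> nat \<Rightarrow> nat set \<Rightarrow> nat \<Rightarrow> nat" where
  "hit_count W \<kappa> B m = card {p \<in> B. hits W \<kappa> p m}"

lemma periodic_hits: "periodic p (hits W \<kappa> p)"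
proof -
  have "(p dvd W * (m + p + 1) + l) = (p dvd W * (m + 1) + l)" for m l
    using periodic_dvd_linear[of p W l] unfolding periodic_def by blast
  then show ?thesis unfolding periodic_def hits_def by blast
qed

lemma hit_count_altdef:
  assumes "finite B"
  shows "hit_count W \<kappa> B m = (\<Sum>p\<in>B. of_bool (hits W \<kappa> p m))"
  using assms by (simp add: hit_count_def Int_def flip: card_eq_sum sum.inter_filter)

lemma mean_hits:
  assumes "coprime W p" "p dvd Y" "Y > 0"
  shows "mean Y (\<lambda>m. of_bool (hits W \<kappa> p m)) \<le> real \<kappa> / real p"
proof -
  have "mean Y (\<lambda>m. of_bool (hits W \<kappa> p m)) \<le>
      mean Y (\<lambda>m. \<Sum>l\<in>{1..\<kappa>}. of_bool (p dvd W * (m + 1) + l))"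
  proof (rule mean_mono)
    fix m
    show "of_bool (hits W \<kappa> p m) \<le> (\<Sum>l\<in>{1..\<kappa>}. of_bool (p dvd W * (m + 1) + l) :: real)"
    proof (cases "hits W \<kappa> p m")
      case True
      then obtain l where "l \<in> {1..\<kappa>}" "p dvd W * (m + 1) + l" by (auto simp: hits_def)
      then show ?thesis
        using member_le_sum[of l "{1..\<kappa>}" "\<lambda>l. of_bool (p dvd W * (m + 1) + l) :: real"] by simp
    qed (simp add: sum_nonneg)
  qed
  also have "\<dots> = (\<Sum>l\<in>{1..\<kappa>}. 1 / real p)"
    unfolding mean_sum using assms by (intro sum.cong mean_dvd_linear refl)
  finally show ?thesis by simp
qed

lemma exp_minus_double_le:
  fixes x :: real
  assumes "0 \<le> x" "x \<le> 1 / 2"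
  shows "exp (- (2 * x)) \<le> 1 - x"
proof -
  have "2 * x * x \<le> 1 * x" using assms by (intro mult_right_mono) auto
  then have "- (2 * x) \<le> ln (1 - x)"
    using ln_one_minus_pos_lower_bound[OF assms] by (simp add: power2_eq_square)
  then have "exp (- (2 * x)) \<le> exp (ln (1 - x))" by simp
  then show ?thesis using assms by simp
qed

section \<open>Means of the Brun weight over one block\<close>

text \<open>The bound \<open>2 * \<kappa> \<le> p\<close> keeps the density
  \<open>\<kappa> / p\<close> of hits at most 1/2, and \<open>Y\<close> is a common period of all
  local factors truncated at \<open>E\<close>.\<close>

locale prime_block =
  fixes B :: "nat set" and W \<kappa> E Y :: nat
  assumes finite_B: "finite B"
    and prime_B: "p \<in> B \<Longrightarrow> prime p"
    and coprime_B: "p \<in> B \<Longrightarrow> coprime W p"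
    and large_B: "p \<in> B \<Longrightarrow> 2 * \<kappa> \<le> p" "p \<in> B \<Longrightarrow> 3 \<le> p"
    and sum_B: "(\<Sum>p\<in>B. 1 / real p) \<le> 4"
    and Y_pos: "Y > 0" and E_pos: "E > 0" and kappa_pos: "\<kappa> > 0"
    and dvd_Y: "(\<Prod>p\<in>B. p ^ E) dvd Y"
begin

text \<open>An even order for which \<open>2 ^ (-D) \<le> exp (-60 * \<kappa>)\<close>; this
  outweighs both the growth of the tail and the smallness of \<open>P0\<close>.\<close>

definition D where "D = 120 * \<kappa>"

definition H where "H k p m = power_count E p (W * (m + 1) + k)"

definition X where "X p m = (of_bool (hits W \<kappa> p m) :: real)"

text \<open>The density of shifts at which no prime of the block hits: the main term to which all
  other means are compared.\<close>

definition P0 where "P0 = mean Y (\<lambda>m. \<Prod>p\<in>B. 1 - X p m)"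

lemma X_cases: "X p m = 0 \<or> X p m = 1"
  by (simp add: X_def)

lemma H_ge_1: "H k p m \<ge> 1"
  by (simp add: H_def power_count_ge_1)

lemma prime_power_dvd_Y: "p \<in> B \<Longrightarrow> p ^ E dvd Y"
  using dvd_Y finite_B by (meson dvd_prodI dvd_trans)

lemma prime_dvd_Y: "p \<in> B \<Longrightarrow> p dvd Y"
  using prime_power_dvd_Y E_pos by (meson dvd_power dvd_trans)

lemma periodic_X: "periodic (p ^ E) (X p)"
proof -
  have "periodic (p ^ E) (hits W \<kappa> p)"
    using E_pos by (intro periodic_dvd[OF periodic_hits]) auto
  then show ?thesis by (simp add: periodic_def X_def)
qed

lemma periodic_H: "periodic (p ^ E) (H k p)"
  using periodic_power_count by (simp add: H_def[abs_def])

lemma mean_prod_B: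
  assumes "\<And>p. periodic (p ^ E) (f p)"
  shows "mean Y (\<lambda>m. \<Prod>p\<in>B. f p m) = (\<Prod>p\<in>B. mean Y (f p))"
  using assms finite_B dvd_Y Y_pos prime_B
  by (intro mean_prod_coprime[where q = "\<lambda>p. p ^ E"]) (auto simp: primes_coprime)

lemma mean_X: "p \<in> B \<Longrightarrow> mean Y (X p) \<le> real \<kappa> / real p"
  unfolding X_def[abs_def] using mean_hits coprime_B prime_dvd_Y Y_pos by blast

lemma mean_H: "p \<in> B \<Longrightarrow> mean Y (H k p) \<le> 1 + 3 * (1 / real p)"
  unfolding H_def[abs_def]
  using mean_power_count[OF prime_B large_B(2) coprime_B prime_power_dvd_Y Y_pos, of p k] by simp

lemma kappa_div_le_half: "p \<in> B \<Longrightarrow> real \<kappa> / real p \<le> 1 / 2"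
  using large_B[of p] by (simp add: field_simps)

lemma P0_eq: "P0 = (\<Prod>p\<in>B. 1 - mean Y (X p))"
proof -
  have "P0 = (\<Prod>p\<in>B. mean Y (\<lambda>m. 1 - X p m))"
    unfolding P0_def using periodic_X by (intro mean_prod_B) (simp add: periodic_def)
  then show ?thesis using Y_pos by (simp add: mean_diff mean_const)
qed

text \<open>Each factor is at least \<open>1 - \<kappa> / p \<ge> exp (- 2 * \<kappa> / p)\<close>,
  and the reciprocals of the primes sum to at most 4.\<close>

lemma P0_lower: "exp (- 8 * real \<kappa>) \<le> P0"
proof -
  have "exp (- 8 * real \<kappa>) \<le> exp (- (2 * real \<kappa> * (\<Sum>p\<in>B. 1 / real p)))"
    using mult_left_mono[OF sum_B, of "2 * real \<kappa>"] by simp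
  also have "\<dots> = (\<Prod>p\<in>B. exp (- (2 * (real \<kappa> / real p))))"
    using finite_B by (simp add: exp_sum sum_distrib_left sum_negf[symmetric] flip: exp_sum)
  also have "\<dots> \<le> (\<Prod>p\<in>B. 1 - mean Y (X p))"
  proof (intro prod_mono conjI)
    fix p assume p: "p \<in> B"
    have "exp (- (2 * (real \<kappa> / real p))) \<le> 1 - real \<kappa> / real p"
      using kappa_div_le_half[OF p] by (intro exp_minus_double_le) auto
    then show "exp (- (2 * (real \<kappa> / real p))) \<le> 1 - mean Y (X p)"
      using mean_X[OF p] by linarith
  qed simp
  finally show ?thesis by (simp add: P0_eq)
qed

lemma P0_pos: "P0 > 0"
  using P0_lower by (rule less_le_trans[OF exp_gt_zero])

lemma even_D: "even D" by (simp add: D_def)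

lemma hit_count_0: "of_bool (hit_count W \<kappa> B m = 0) = (\<Prod>p\<in>B. 1 - X p m)"
proof -
  have "hit_count W \<kappa> B m = 0 \<longleftrightarrow> (\<forall>p\<in>B. \<not> hits W \<kappa> p m)"
    using finite_B by (auto simp: hit_count_def)
  moreover have "(\<Prod>p\<in>B. 1 - X p m) = 0" if "p \<in> B" "hits W \<kappa> p m" for p
    using that finite_B by (intro prod_zero) (auto simp: X_def intro!: bexI[of _ p])
  moreover have "(\<Prod>p\<in>B. 1 - X p m) = 1" if "\<forall>p\<in>B. \<not> hits W \<kappa> p m"
    using that by (simp add: X_def)
  ultimately show ?thesis by auto
qed

lemma power_hit_count: "3 ^ hit_count W \<kappa> B m = (\<Prod>p\<in>B. 1 + 2 * X p m)"
proof -
  have "3 ^ hit_count W \<kappa> B m = (\<Prod>p\<in>B. 3 ^ of_bool (hits W \<kappa> p m) :: real)"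
    by (simp only: hit_count_altdef[OF finite_B] power_sum)
  also have "\<dots> = (\<Prod>p\<in>B. 1 + 2 * X p m)"
    by (intro prod.cong) (auto simp: X_def)
  finally show ?thesis .
qed

text \<open>The weight majorises the indicator of no hits: it is 1 there and nonnegative
  elsewhere.\<close>

lemma mean_brun_lower: "P0 \<le> mean Y (\<lambda>m. brun D (hit_count W \<kappa> B m))"
  unfolding P0_def hit_count_0[symmetric]
proof (rule mean_mono)
  show "of_bool (hit_count W \<kappa> B m = 0) \<le> brun D (hit_count W \<kappa> B m)" for m
    using brun_nonneg[OF even_D, of "hit_count W \<kappa> B m"] by (cases "hit_count W \<kappa> B m = 0") auto
qed

text \<open>The error term of \<open>brun_le\<close>, multiplied by the local factors, is a product
  over independent primes; its mean is exponential in \<open>\<kappa>\<close> and is beaten by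
  \<open>2 ^ D\<close>.\<close>

lemma mean_brun_tail:
  "mean Y (\<lambda>m. \<Prod>p\<in>B. (1 + 2 * X p m) * H k p m) / 2 ^ D \<le> exp (- real \<kappa>) * P0"
proof -
  have "mean Y (\<lambda>m. \<Prod>p\<in>B. (1 + 2 * X p m) * H k p m)
      = (\<Prod>p\<in>B. mean Y (\<lambda>m. (1 + 2 * X p m) * H k p m))"
    using periodic_X periodic_H by (intro mean_prod_B) (simp add: periodic_def)
  also have "\<dots> \<le> (\<Prod>p\<in>B. exp ((2 * real \<kappa> + 9) * (1 / real p)))"
  proof (intro prod_mono conjI)
    fix p assume p: "p \<in> B"
    \<comment> \<open>Linearising pointwise avoids a joint mean of \<open>X\<close> and
      \<open>H\<close>: for \<open>X = 1\<close> both sides agree, and for \<open>X = 0\<close> the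
      claim follows from \<open>H \<ge> 1\<close>.\<close>
    have "(1 + 2 * X p m) * H k p m \<le> 1 + (2 * X p m + 3 * (H k p m - 1))" for m
      using X_cases[of p m] H_ge_1[of k p m] by auto
    then have "mean Y (\<lambda>m. (1 + 2 * X p m) * H k p m) \<le> mean Y (\<lambda>m. 1 + (2 * X p m + 3 * (H k p m - 1)))"
      by (rule mean_mono)
    also have "\<dots> = 1 + 2 * mean Y (X p) + 3 * (mean Y (H k p) - 1)"
      using Y_pos by (simp only: mean_add mean_cmult mean_diff mean_const)
    also have "\<dots> \<le> 1 + 2 * (real \<kappa> / real p) + 9 * (1 / real p)"
    proof -
      have "1 + 2 * x + 3 * (y - 1) \<le> 1 + 2 * a + 9 * b" if "x \<le> a" "y \<le> 1 + 3 * b" for x y a b :: real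
        using that by (simp add: algebra_simps)
      from this[OF mean_X[OF p] mean_H[OF p, of k]] show ?thesis .
    qed
    also have "\<dots> = 1 + (2 * real \<kappa> + 9) * (1 / real p)"
      by (simp add: algebra_simps add_divide_distrib)
    also have "\<dots> \<le> exp ((2 * real \<kappa> + 9) * (1 / real p))" by (rule exp_ge_add_one_self)
    finally show "mean Y (\<lambda>m. (1 + 2 * X p m) * H k p m) \<le> exp ((2 * real \<kappa> + 9) * (1 / real p))" .
    show "0 \<le> mean Y (\<lambda>m. (1 + 2 * X p m) * H k p m)"
    proof (rule mean_nonneg)
      show "0 \<le> (1 + 2 * X p m) * H k p m" for m
        using X_cases[of p m] H_ge_1[of k p m] by auto
    qed
  qed
  also have "\<dots> = exp ((2 * real \<kappa> + 9) * (\<Sum>p\<in>B. 1 / real p))"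
    using finite_B by (simp only: exp_sum[symmetric] sum_distrib_left)
  also have "\<dots> \<le> exp ((2 * real \<kappa> + 9) * 4)"
    using sum_B by (intro iffD2[OF exp_le_cancel_iff] mult_left_mono) auto
  finally have "mean Y (\<lambda>m. \<Prod>p\<in>B. (1 + 2 * X p m) * H k p m) / 2 ^ D \<le> exp ((2 * real \<kappa> + 9) * 4) / 2 ^ D"
    by (intro divide_right_mono) auto
  also have "exp ((2 * real \<kappa> + 9) * 4) / 2 ^ D = exp ((2 * real \<kappa> + 9) * 4 - real D * ln 2)"
    by (simp add: exp_diff exp_of_nat_mult)
  also have "\<dots> \<le> exp (- real \<kappa> + - 8 * real \<kappa>)"
  proof -
    have "ln (1 / 2) \<le> 1 / 2 - (1::real)" by (intro ln_le_minus_one) simp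
    then have "1 / 2 \<le> ln (2::real)" by (simp add: ln_div)
    then have "real D * (1 / 2) \<le> real D * ln 2" by (intro mult_left_mono) auto
    then have "60 * real \<kappa> \<le> real D * ln 2" by (simp add: D_def)
    \<comment> \<open>Needed is
      \<open>4 * (2 * \<kappa> + 9) + 9 * \<kappa> \<le> 60 * \<kappa>\<close>, where
      \<open>\<kappa> \<ge> 1\<close> absorbs the constant 36.\<close>
    moreover have "real \<kappa> \<ge> 1" using kappa_pos by simp
    ultimately show ?thesis by (simp add: algebra_simps)
  qed
  also have "\<dots> = exp (- real \<kappa>) * exp (- 8 * real \<kappa>)" by (rule exp_add)
  also have "\<dots> \<le> exp (- real \<kappa>) * P0" using P0_lower by (intro mult_left_mono) auto
  finally show ?thesis .
qed

lemma mean_brun_upper: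
  "mean Y (\<lambda>m. brun D (hit_count W \<kappa> B m) * (\<Prod>p\<in>B. H k p m)) \<le>
    mean Y (\<lambda>m. \<Prod>p\<in>B. (1 - X p m) * H k p m) + exp (- real \<kappa>) * P0"
proof -
  have "brun D (hit_count W \<kappa> B m) * (\<Prod>p\<in>B. H k p m) \<le>
      (\<Prod>p\<in>B. (1 - X p m) * H k p m) + (1 / 2 ^ D) * (\<Prod>p\<in>B. (1 + 2 * X p m) * H k p m)" for m
  proof -
    have "0 \<le> (\<Prod>p\<in>B. H k p m)" using H_ge_1 by (intro prod_nonneg) (metis order.trans zero_le_one)
    moreover have "brun D (hit_count W \<kappa> B m) \<le>
        (\<Prod>p\<in>B. 1 - X p m) + (1 / 2 ^ D) * (\<Prod>p\<in>B. 1 + 2 * X p m)"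
      using brun_le[OF even_D, of "hit_count W \<kappa> B m"] by (simp add: hit_count_0 power_hit_count)
    ultimately show ?thesis
      unfolding prod.distrib by (simp only: mult.assoc[symmetric] distrib_right[symmetric] mult_right_mono)
  qed
  then have "mean Y (\<lambda>m. brun D (hit_count W \<kappa> B m) * (\<Prod>p\<in>B. H k p m)) \<le>
      mean Y (\<lambda>m. (\<Prod>p\<in>B. (1 - X p m) * H k p m) + (1 / 2 ^ D) * (\<Prod>p\<in>B. (1 + 2 * X p m) * H k p m))"
    by (rule mean_mono)
  then show ?thesis using mean_brun_tail[of k] unfolding mean_add mean_cmult by simp
qed

text \<open>A prime of the block dividing \<open>W * (m + 1) + k\<close> with
  \<open>k \<le> \<kappa>\<close> is a hit, so without hits all local factors are 1 and only the
  tail costs anything. The form \<open>exp (1 / \<kappa>)\<close> makes the losses summable over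
  blocks.\<close>

lemma mean_brun_sieved:
  assumes "1 \<le> k" "k \<le> \<kappa>"
  shows "mean Y (\<lambda>m. brun D (hit_count W \<kappa> B m) * (\<Prod>p\<in>B. H k p m)) \<le>
    exp (1 / real \<kappa>) * mean Y (\<lambda>m. brun D (hit_count W \<kappa> B m))"
proof -
  have eq: "(1 - X p m) * H k p m = 1 - X p m" for p m
    using assms power_count_eq_1[of p "W * (m + 1) + k" E]
    by (cases "hits W \<kappa> p m") (auto simp: X_def H_def hits_def)
  have "mean Y (\<lambda>m. brun D (hit_count W \<kappa> B m) * (\<Prod>p\<in>B. H k p m)) \<le> (1 + exp (- real \<kappa>)) * P0"
    using mean_brun_upper[of k] by (simp only: eq P0_def[symmetric] distrib_right mult_1)
  also have "\<dots> \<le> exp (1 / real \<kappa>) * P0"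
  proof (intro mult_right_mono)
    have "exp (- real \<kappa>) \<le> 1 / real \<kappa>"
    proof -
      have "real \<kappa> \<le> exp (real \<kappa>)" by (rule order.trans[OF _ exp_ge_add_one_self]) simp
      then show ?thesis using kappa_pos by (simp add: exp_minus field_simps)
    qed
    then show "1 + exp (- real \<kappa>) \<le> exp (1 / real \<kappa>)"
      using exp_ge_add_one_self[of "1 / real \<kappa>"] by linarith
  qed (use P0_pos in simp)
  also have "\<dots> \<le> exp (1 / real \<kappa>) * mean Y (\<lambda>m. brun D (hit_count W \<kappa> B m))"
    using mean_brun_lower by (intro mult_left_mono) auto
  finally show ?thesis .
qed

text \<open>Without any restriction on \<open>k\<close>, the bounded sum of reciprocals still limits
  the cost of a block to a constant factor.\<close>

lemma mean_brun_unsieved: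
  "mean Y (\<lambda>m. brun D (hit_count W \<kappa> B m) * (\<Prod>p\<in>B. H k p m)) \<le>
    exp 25 * mean Y (\<lambda>m. brun D (hit_count W \<kappa> B m))"
proof -
  have "mean Y (\<lambda>m. \<Prod>p\<in>B. (1 - X p m) * H k p m) = (\<Prod>p\<in>B. mean Y (\<lambda>m. (1 - X p m) * H k p m))"
    using periodic_X periodic_H by (intro mean_prod_B) (simp add: periodic_def)
  also have "\<dots> \<le> (\<Prod>p\<in>B. (1 - mean Y (X p)) * exp (6 * (1 / real p)))"
  proof (intro prod_mono conjI)
    fix p assume p: "p \<in> B"
    \<comment> \<open>Equality for \<open>X = 0\<close>; for \<open>X = 1\<close> the left side
      vanishes and \<open>H \<ge> 1\<close>.\<close>
    have "(1 - X p m) * H k p m \<le> (1 - X p m) + (H k p m - 1)" for m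
      using X_cases[of p m] H_ge_1[of k p m] by auto
    then have "mean Y (\<lambda>m. (1 - X p m) * H k p m) \<le> mean Y (\<lambda>m. (1 - X p m) + (H k p m - 1))"
      by (rule mean_mono)
    also have "\<dots> = (1 - mean Y (X p)) + (mean Y (H k p) - 1)"
      using Y_pos by (simp only: mean_add mean_diff mean_const)
    also have "\<dots> \<le> (1 - mean Y (X p)) + (1 - mean Y (X p)) * (6 * (1 / real p))"
    proof -
      \<comment> \<open>Doubling the coefficient 3 of \<open>1 / p\<close> to 6 lets
        \<open>1 - mean Y (X p)\<close> be factored out, which reproduces \<open>P0\<close>.\<close>
      have "1 / 2 \<le> 1 - mean Y (X p)"
        using mean_X[OF p] kappa_div_le_half[OF p] by linarith
      then have "1 / 2 * (6 * (1 / real p)) \<le> (1 - mean Y (X p)) * (6 * (1 / real p))"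
        by (rule mult_right_mono) simp
      then show ?thesis using mean_H[OF p, of k] by simp
    qed
    also have "\<dots> = (1 - mean Y (X p)) * (1 + 6 * (1 / real p))" by (simp add: algebra_simps)
    also have "\<dots> \<le> (1 - mean Y (X p)) * exp (6 * (1 / real p))"
      using mean_X[OF p] kappa_div_le_half[OF p] by (intro mult_left_mono exp_ge_add_one_self) linarith
    finally show "mean Y (\<lambda>m. (1 - X p m) * H k p m) \<le> (1 - mean Y (X p)) * exp (6 * (1 / real p))" .
    show "0 \<le> mean Y (\<lambda>m. (1 - X p m) * H k p m)"
    proof (rule mean_nonneg)
      show "0 \<le> (1 - X p m) * H k p m" for m
        using X_cases[of p m] H_ge_1[of k p m] by auto
    qed
  qed
  also have "\<dots> = P0 * exp (6 * (\<Sum>p\<in>B. 1 / real p))"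
    using finite_B by (simp only: prod.distrib P0_eq exp_sum[symmetric] sum_distrib_left)
  also have "\<dots> \<le> P0 * exp 24"
    using sum_B P0_pos by (intro mult_left_mono iffD2[OF exp_le_cancel_iff]) auto
  finally have "mean Y (\<lambda>m. brun D (hit_count W \<kappa> B m) * (\<Prod>p\<in>B. H k p m)) \<le> P0 * exp 24 + exp (- real \<kappa>) * P0"
    using mean_brun_upper[of k] by linarith
  also have "\<dots> = (exp 24 + exp (- real \<kappa>)) * P0" by (simp add: algebra_simps)
  also have "\<dots> \<le> exp 25 * P0"
  proof (intro mult_right_mono)
    \<comment> \<open>The exponent rises from 24 to 25 to absorb the tail.\<close>
    have "exp (- real \<kappa>) \<le> exp 24" by simp
    moreover have "(25::real) = 24 + 1" by simp
    then have "exp 25 = exp 24 * exp (1::real)" by (metis exp_add)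
    moreover have "exp 24 * 2 \<le> exp 24 * exp (1::real)"
      using exp_ge_add_one_self[of "1::real"] by (intro mult_left_mono) auto
    ultimately show "exp 24 + exp (- real \<kappa>) \<le> exp 25" by linarith
  qed (use P0_pos in simp)
  also have "\<dots> \<le> exp 25 * mean Y (\<lambda>m. brun D (hit_count W \<kappa> B m))"
    using mean_brun_lower by (intro mult_left_mono) auto
  finally show ?thesis .
qed

end

subsection \<open>The sieve\<close>

lemma sum_powers_lessThan: "(\<Sum>i<n. (2::nat) ^ i) < 2 ^ n"
  by (induction n) auto

lemma sum_reflect:
  fixes f :: "nat \<Rightarrow> 'a :: comm_monoid_add"
  shows "(\<Sum>s<n. f (n - s)) = (\<Sum>i<n. f (Suc i))"
  by (rule sum.reindex_bij_witness[of _ "\<lambda>i. n - Suc i" "\<lambda>s. n - Suc s"]) (auto simp: Suc_diff_Suc)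

lemma sum_inverse_squares_le: "(\<Sum>k\<in>{1..n}. 1 / real k ^ 2) \<le> 2"
proof -
  have "(\<Sum>k\<in>{1..Suc n}. 1 / real k ^ 2) \<le> 2 - 1 / real (Suc n)" for n
  proof (induction n)
    case (Suc n)
    have "1 / real (Suc (Suc n)) ^ 2 \<le> 1 / (real (Suc n) * real (Suc (Suc n)))"
      by (intro divide_left_mono) (auto simp: power2_eq_square)
    also have "\<dots> = 1 / real (Suc n) - 1 / real (Suc (Suc n))" by (simp add: field_simps)
    finally show ?case using Suc by simp
  qed simp
  note bound = this
  show ?thesis
  proof (cases n)
    case (Suc n')
    have "2 - 1 / real (Suc n') \<le> 2" by simp
    with bound show ?thesis unfolding Suc by (rule order.trans)
  qed simp
qed

text \<open>If every \<open>m\<close> failed for some \<open>k\<close>, the combination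
  \<open>G\<close> with weights \<open>k powr - (a + 2)\<close> would be at least
  \<open>3 * c\<close> everywhere, whereas its \<open>\<nu>\<close>-weighted average is at most
  \<open>c\<close> times the sum of \<open>1 / k ^ 2\<close>, hence at most
  \<open>2 * c\<close>.\<close>

lemma ex_small_values:
  fixes g :: "nat \<Rightarrow> nat \<Rightarrow> real"
  assumes "c > 0" "\<And>m. \<nu> m \<ge> 0" "\<And>k m. g k m \<ge> 0" "mean X \<nu> > 0"
    and le: "\<And>k. k \<in> {1..X} \<Longrightarrow> mean X (\<lambda>m. \<nu> m * g k m) \<le> c * real k powr a * mean X \<nu>"
  shows "\<exists>m<X. \<forall>k\<in>{1..X}. g k m \<le> 3 * c * real k powr (a + 2)"
proof (rule ccontr)
  assume neg: "\<not> ?thesis"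
  define G where "G = (\<lambda>m. \<Sum>k\<in>{1..X}. real k powr - (a + 2) * g k m)"
  have G: "3 * c \<le> G m" if m: "m < X" for m
  proof -
    obtain k where k: "k \<in> {1..X}" "3 * c * real k powr (a + 2) < g k m"
      using neg m by (meson not_le)
    have "real k powr - (a + 2) * real k powr (a + 2) = 1"
      using k by (simp only: powr_add[symmetric]) simp
    then have "3 * c = real k powr - (a + 2) * (3 * c * real k powr (a + 2))"
      by (simp only: mult.left_commute[of _ "3 * c"] mult_1_right)
    also have "\<dots> \<le> real k powr - (a + 2) * g k m"
      using k by (intro mult_left_mono) auto
    also have "\<dots> \<le> G m"
      unfolding G_def using k assms(3) by (intro member_le_sum) auto
    finally show ?thesis .
  qed
  have X: "X > 0" using assms(4) by (auto simp: mean_def intro!: gr0I)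
  have "3 * c * mean X \<nu> = mean X (\<lambda>m. 3 * c * \<nu> m)" by (simp only: mean_cmult)
  also have "\<dots> \<le> mean X (\<lambda>m. \<nu> m * G m)"
    unfolding mean_def
  proof (intro divide_right_mono sum_mono)
    fix m assume "m \<in> {..<X}"
    then have "\<nu> m * (3 * c) \<le> \<nu> m * G m" using G assms(2) by (intro mult_left_mono) auto
    then show "3 * c * \<nu> m \<le> \<nu> m * G m" by (simp add: mult_ac)
  qed simp
  also have "\<dots> = mean X (\<lambda>m. \<Sum>k\<in>{1..X}. real k powr - (a + 2) * (\<nu> m * g k m))"
    unfolding G_def sum_distrib_left by (simp only: mult_ac)
  also have "\<dots> = (\<Sum>k\<in>{1..X}. real k powr - (a + 2) * mean X (\<lambda>m. \<nu> m * g k m))"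
    by (simp only: mean_sum mean_cmult)
  also have "\<dots> \<le> (\<Sum>k\<in>{1..X}. real k powr - (a + 2) * (c * real k powr a * mean X \<nu>))"
    using le by (intro sum_mono mult_left_mono) auto
  also have "\<dots> = (\<Sum>k\<in>{1..X}. c * mean X \<nu> * (1 / real k ^ 2))"
  proof (intro sum.cong refl)
    fix k assume "k \<in> {1..X}"
    then have "real k powr - (a + 2) * real k powr a = 1 / real k ^ 2"
      by (simp add: powr_add[symmetric] powr_minus_divide powr_numeral)
    then show "real k powr - (a + 2) * (c * real k powr a * mean X \<nu>) = c * mean X \<nu> * (1 / real k ^ 2)"
      by (metis mult.assoc mult.commute)
  qed
  also have "\<dots> \<le> c * mean X \<nu> * 2"
    unfolding sum_distrib_left[symmetric]
    using sum_inverse_squares_le assms by (intro mult_left_mono) auto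
  finally have "3 * (c * mean X \<nu>) \<le> 2 * (c * mean X \<nu>)" by simp
  moreover have "c * mean X \<nu> > 0" using assms by simp
  ultimately show False by linarith
qed

lemma card_prime_divisors_le:
  fixes k :: nat
  assumes "k > 0" "\<And>p. p \<in> A \<Longrightarrow> prime p" "\<And>p. p \<in> A \<Longrightarrow> p dvd k"
  shows "2 ^ card A \<le> k"
proof -
  have fin: "finite A" using assms by (intro finite_subset[of A "{..k}"]) (auto dest: dvd_imp_le)
  have "(\<Prod>p\<in>A. 2) \<le> \<Prod>A" using assms(2) by (intro prod_mono) (auto dest: prime_ge_2_nat)
  also have "\<dots> \<le> k" using fin assms by (intro dvd_imp_le prod_primes_dvd) auto
  finally show ?thesis by simp
qed

lemma size_prime_factorization_le:
  assumes "n > 0" shows "2 ^ size (prime_factorization n) \<le> (n::nat)"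
proof -
  have "2 ^ size M \<le> \<Prod>\<^sub># M" if "\<And>p. p \<in># M \<Longrightarrow> p \<ge> 2" for M :: "nat multiset"
    using that by (induction M) (auto intro!: mult_le_mono)
  from this[of "prime_factorization n"] show ?thesis
    using assms by (auto simp: prod_mset_prime_factorization_weak in_prime_factors_imp_prime prime_ge_2_nat)
qed

text \<open>After reindexing, this counts the blocks too short to sieve at \<open>k\<close>.\<close>

lemma card_powers_less:
  assumes "k \<ge> (1::nat)"
  shows "(\<Sum>i<n. of_bool (2 ^ Suc i < k)) \<le> log 2 (real k)"
proof -
  have sub: "{i. i < n \<and> 2 ^ Suc i < k} \<subseteq> {..<nat \<lfloor>log 2 (real k)\<rfloor>}"
  proof safe
    fix i assume "2 ^ Suc i < k"
    then have "real (2 ^ Suc i) \<le> real k" by (simp only: of_nat_le_iff less_imp_le)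
    then have "real (Suc i) \<le> log 2 (real k)"
      by (subst le_log_iff) (use assms in \<open>auto simp: powr_realpow[symmetric] powr_add\<close>)
    then show "i < nat \<lfloor>log 2 (real k)\<rfloor>" by linarith
  qed
  have "(\<Sum>i<n. of_bool (2 ^ Suc i < k)) = real (card {i. i < n \<and> 2 ^ Suc i < k})"
    by (simp add: Int_def)
  also have "\<dots> \<le> real (nat \<lfloor>log 2 (real k)\<rfloor>)"
    using card_mono[OF _ sub] by simp
  also have "\<dots> \<le> log 2 (real k)" using assms by simp
  finally show ?thesis .
qed

section \<open>Parameters and independence of the blocks\<close>

locale sieve =
  fixes u :: nat
  assumes u_ge: "u \<ge> 3"
begin

text \<open>With this choice the small primes are those up to \<open>2 ^ S\<close>, which keeps
  \<open>W \<le> M\<close>, while primes of scale \<open>s \<ge> u\<close> are still at least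
  \<open>2 * \<kappa> s\<close>.\<close>

definition S where "S = (4::nat) ^ u"

text \<open>Stopping 14 scales below \<open>S\<close> makes \<open>z ^ (4 ^ 14) = M\<close>, and
  this gap absorbs the constant 960 in the level of the weight.\<close>

definition scales where "scales = {u..<S - 14}"

definition block where "block s = {p::nat. prime p \<and> 2 ^ (4 ^ s) < p \<and> p \<le> 2 ^ (4 * 4 ^ s)}"

definition small where "small = {p::nat. prime p \<and> p \<le> 2 ^ (4 ^ u)}"

definition W where "W = \<Prod>small"

definition z where "z = (2::nat) ^ (4 ^ (S - 14))"

definition primes where "primes = {p::nat. prime p \<and> p \<le> z}"

text \<open>The prime powers are periods of the local factors; \<open>fact z\<close> makes every
  \<open>d \<le> z\<close> divide \<open>Y\<close>.\<close>

definition Y where "Y = (\<Prod>p\<in>primes. p ^ z) * fact z"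

definition \<kappa> where "\<kappa> s = (2::nat) ^ (S - s)"

definition U where "U s m = brun (120 * \<kappa> s) (hit_count W (\<kappa> s) (block s) m)"

definition \<nu> where "\<nu> m = (\<Prod>s\<in>scales. U s m)"

definition M where "M = (2::nat) ^ (4 ^ S)"

definition F where "F k p m = power_count z p (W * (m + 1) + k)"

lemma S_ge: "S \<ge> 64"
  using power_increasing[OF u_ge, of "4::nat"] by (simp add: S_def)

lemma finite_small [simp]: "finite small"
  by (rule finite_subset[of _ "{..2 ^ (4 ^ u)}"]) (auto simp: small_def)

lemma finite_primes [simp]: "finite primes"
  by (rule finite_subset[of _ "{..z}"]) (auto simp: primes_def)

lemma finite_block [simp]: "finite (block s)"
  by (rule finite_subset[of _ "{..2 ^ (4 * 4 ^ s)}"]) (auto simp: block_def)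

lemma finite_scales [simp]: "finite scales"
  by (simp add: scales_def)

lemma u_less: "u < S - 14"
proof -
  have "n < 4 ^ n - 14" if "n \<ge> 3" for n :: nat
    using that by (induction n rule: dec_induct) auto
  then show ?thesis using u_ge by (simp add: S_def)
qed

lemma prime_small: "p \<in> small \<Longrightarrow> prime p"
  by (simp add: small_def)

lemma Y_pos: "Y > 0"
  by (auto simp: Y_def primes_def prime_gt_0_nat)

lemma W_pos: "W > 0"
  by (auto simp: W_def small_def prime_gt_0_nat)

lemma primes_below:
  "u \<le> v \<Longrightarrow> {p::nat. prime p \<and> p \<le> 2 ^ (4 ^ v)} = small \<union> (\<Union>s\<in>{u..<v}. block s)"
proof (induction v rule: dec_induct)
  case base
  then show ?case by (simp add: small_def)
next
  case (step v)
  have le: "(2::nat) ^ (4 ^ v) \<le> 2 ^ (4 * 4 ^ v)" by (intro power_increasing) auto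
  have "{p::nat. prime p \<and> p \<le> 2 ^ (4 ^ Suc v)} = {p. prime p \<and> p \<le> 2 ^ (4 ^ v)} \<union> block v"
    using order.trans[OF _ le] by (auto simp: block_def not_le)
  then show ?case using step by (auto simp: atLeastLessThanSuc)
qed

lemma primes_eq: "primes = small \<union> (\<Union>s\<in>scales. block s)"
  using primes_below[of "S - 14"] u_less by (simp add: primes_def z_def scales_def)

lemma block_disjoint:
  assumes "s \<noteq> t" shows "block s \<inter> block t = {}"
proof -
  have "block s \<inter> block t = {}" if "s < t" for s t
  proof -
    have "(4::nat) * 4 ^ s \<le> 4 ^ t"
      using that power_increasing[of "Suc s" t "4::nat"] by simp
    then have le: "(2::nat) ^ (4 * 4 ^ s) \<le> 2 ^ (4 ^ t)" by (rule power_increasing) simp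
    have False if "p \<in> block s" "p \<in> block t" for p
      using that le unfolding block_def mem_Collect_eq by linarith
    then show ?thesis by auto
  qed
  from this[of s t] this[of t s] show ?thesis using assms by (cases "s < t") auto
qed

lemma small_disjoint:
  assumes "s \<in> scales" shows "small \<inter> block s = {}"
proof -
  have le: "(2::nat) ^ (4 ^ u) \<le> 2 ^ (4 ^ s)"
    using assms by (intro power_increasing) (auto simp: scales_def)
  have False if "p \<in> small" "p \<in> block s" for p
    using that le unfolding small_def block_def mem_Collect_eq by linarith
  then show ?thesis by auto
qed

lemma prod_primes:
  "(\<Prod>p\<in>primes. f p) = (\<Prod>p\<in>small. f p) * (\<Prod>s\<in>scales. \<Prod>p\<in>block s. (f p :: 'a :: comm_monoid_mult))"
proof -
  have "(\<Prod>p\<in>primes. f p) = (\<Prod>p\<in>small. f p) * (\<Prod>p\<in>(\<Union>s\<in>scales. block s). f p)"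
    unfolding primes_eq using small_disjoint by (intro prod.union_disjoint) auto
  also have "(\<Prod>p\<in>(\<Union>s\<in>scales. block s). f p) = (\<Prod>s\<in>scales. \<Prod>p\<in>block s. f p)"
    using block_disjoint by (intro prod.UNION_disjoint) auto
  finally show ?thesis .
qed

lemma period_dvd_Y: "(\<Prod>p\<in>small. p ^ z) * (\<Prod>s\<in>scales. \<Prod>p\<in>block s. p ^ z) dvd Y"
  unfolding Y_def prod_primes by simp

lemma prime_block_scale:
  assumes s: "s \<in> scales"
  shows "prime_block (block s) W (\<kappa> s) z Y"
proof
  show "finite (block s)" by simp
  show "Y > 0" by (rule Y_pos)
  show "z > 0" by (simp add: z_def)
  show "\<kappa> s > 0" by (simp add: \<kappa>_def)
  show "(\<Sum>p\<in>block s. 1 / real p) \<le> 4"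
    unfolding block_def by (rule sum_inverse_primes_quadrupling) simp
  have "(\<Prod>p\<in>block s. p ^ z) dvd (\<Prod>s\<in>scales. \<Prod>p\<in>block s. p ^ z)"
    using s by (intro dvd_prodI) auto
  then show "(\<Prod>p\<in>block s. p ^ z) dvd Y"
    using period_dvd_Y by (meson dvd_mult dvd_trans)
next
  fix p assume p: "p \<in> block s"
  then show "prime p" by (simp add: block_def)
  have "p \<notin> small" using small_disjoint[OF s] p by auto
  then have "coprime q p" if "q \<in> small" for q
    using that \<open>prime p\<close> prime_small[OF that] by (metis primes_coprime)
  then show "coprime W p" unfolding W_def by (intro prod_coprime_left)
  have us: "u \<le> s" using s by (simp add: scales_def)
  \<comment> \<open>Here \<open>S = 4 ^ u \<le> 4 ^ s\<close> turns the bound into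
    \<open>2 * \<kappa> s \<le> 2 ^ (4 ^ s)\<close>, the lower end of the block.\<close>
  have "Suc (S - s) \<le> S" using us u_ge S_ge by linarith
  also have "\<dots> \<le> 4 ^ s" using us unfolding S_def by (intro power_increasing) auto
  finally have "(2::nat) ^ Suc (S - s) \<le> 2 ^ (4 ^ s)" by (rule power_increasing) simp
  then show "2 * \<kappa> s \<le> p" using p by (simp add: block_def \<kappa>_def)
  have "(2::nat) ^ 1 \<le> 2 ^ (4 ^ s)" by (intro power_increasing) auto
  then show "3 \<le> p" using p by (simp add: block_def)
qed

lemma periodic_F: "periodic (p ^ z) (F k p)"
  using periodic_power_count by (simp add: F_def[abs_def])

lemma periodic_U: "periodic (\<Prod>p\<in>block s. p ^ z) (U s)"
proof -
  have "hits W (\<kappa> s) p (m + (\<Prod>p\<in>block s. p ^ z)) = hits W (\<kappa> s) p m" if "p \<in> block s" for p m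
  proof -
    have "p dvd p ^ z" by (rule dvd_power) (simp add: z_def)
    also have "p ^ z dvd (\<Prod>p\<in>block s. p ^ z)" using that by (intro dvd_prodI) auto
    finally show ?thesis using periodic_dvd[OF periodic_hits] unfolding periodic_def by blast
  qed
  then show ?thesis
    unfolding periodic_def U_def hit_count_def by (metis (mono_tags, lifting) Collect_cong)
qed

lemma U_nonneg: "U s m \<ge> 0"
  unfolding U_def by (rule brun_nonneg) simp

lemma \<nu>_nonneg: "\<nu> m \<ge> 0"
  unfolding \<nu>_def by (intro prod_nonneg U_nonneg)

lemma coprime_blocks:
  assumes "s \<noteq> t"
  shows "coprime (\<Prod>p\<in>block s. p ^ z) (\<Prod>p\<in>block t. p ^ z)"
proof (intro prod_coprime_left prod_coprime_right)
  fix p q assume "p \<in> block s" "q \<in> block t"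
  moreover from this have "p \<noteq> q" using block_disjoint[OF assms] by auto
  ultimately show "coprime (p ^ z) (q ^ z)" by (auto simp: block_def primes_coprime)
qed

lemma coprime_small_blocks:
  "coprime (\<Prod>p\<in>small. p ^ z) (\<Prod>s\<in>scales. \<Prod>p\<in>block s. p ^ z)"
proof (intro prod_coprime_left prod_coprime_right)
  fix p s q assume "p \<in> small" "s \<in> scales" "q \<in> block s"
  moreover from this have "p \<noteq> q" using small_disjoint by auto
  ultimately show "coprime (p ^ z) (q ^ z)" by (auto simp: block_def small_def primes_coprime)
qed

section \<open>Weighted means over a full period\<close>

lemma mean_prod_scales:
  assumes "\<And>s. periodic (\<Prod>p\<in>block s. p ^ z) (f s)"
  shows "mean Y (\<lambda>m. \<Prod>s\<in>scales. f s m) = (\<Prod>s\<in>scales. mean Y (f s))"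
  using assms coprime_blocks period_dvd_Y Y_pos
  by (intro mean_prod_coprime[where q = "\<lambda>s. \<Prod>p\<in>block s. p ^ z"]) (auto dest: dvd_mult_right)

lemma mean_\<nu>: "mean Y \<nu> = (\<Prod>s\<in>scales. mean Y (U s))"
  using mean_prod_scales[of U] periodic_U by (simp add: \<nu>_def[abs_def])

lemma mean_U_block:
  assumes "s \<in> scales" "k \<ge> 1"
  shows "mean Y (\<lambda>m. U s m * (\<Prod>p\<in>block s. F k p m)) \<le>
    exp ((1 / 2) ^ (S - s) + 25 * of_bool (2 ^ (S - s) < k)) * mean Y (U s)"
proof -
  interpret prime_block "block s" W "\<kappa> s" z Y by (rule prime_block_scale[OF assms(1)])
  have H: "H = F" by (intro ext) (simp add: H_def F_def)
  have U: "brun D (hit_count W (\<kappa> s) (block s) m) = U s m" for m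
    by (simp only: U_def D_def)
  have nn: "mean Y (U s) \<ge> 0" by (intro mean_nonneg U_nonneg)
  show ?thesis
  proof (cases "k \<le> \<kappa> s")
    case True
    have "1 / real (\<kappa> s) = (1 / 2) ^ (S - s)" by (simp add: \<kappa>_def power_divide)
    moreover have "mean Y (\<lambda>m. U s m * (\<Prod>p\<in>block s. F k p m)) \<le> exp (1 / real (\<kappa> s)) * mean Y (U s)"
      using mean_brun_sieved[OF assms(2) True] by (simp only: H U)
    ultimately show ?thesis using True by (simp add: \<kappa>_def)
  next
    case False
    have "mean Y (\<lambda>m. U s m * (\<Prod>p\<in>block s. F k p m)) \<le> exp 25 * mean Y (U s)"
      using mean_brun_unsieved[of k] by (simp only: H U)
    also have "\<dots> \<le> exp ((1 / 2) ^ (S - s) + 25 * of_bool (2 ^ (S - s) < k)) * mean Y (U s)"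
      using False nn by (intro mult_right_mono) (auto simp: \<kappa>_def)
    finally show ?thesis .
  qed
qed

text \<open>A small prime divides \<open>W\<close>, so it divides \<open>W * (m + 1) + k\<close>
  only if it divides \<open>k\<close>. Each prime divisor of \<open>k\<close> costs at most 8, hence
  all together at most \<open>8 ^ \<omega>(k) \<le> k ^ 3\<close>.\<close>

lemma mean_prod_small:
  assumes "k \<ge> 1"
  shows "mean Y (\<lambda>m. \<Prod>p\<in>small. F k p m) \<le> real k ^ 3"
proof -
  have dvd: "(\<Prod>p\<in>small. p ^ z) dvd Y" using period_dvd_Y by (rule dvd_mult_left)
  have "mean Y (\<lambda>m. \<Prod>p\<in>small. F k p m) = (\<Prod>p\<in>small. mean Y (F k p))"
    using periodic_F dvd Y_pos
    by (intro mean_prod_coprime[where q = "\<lambda>p. p ^ z"]) (auto simp: small_def primes_coprime)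
  also have "\<dots> \<le> (\<Prod>p\<in>small. if p dvd k then 8 else 1)"
  proof (intro prod_mono conjI)
    fix p assume p: "p \<in> small"
    show "0 \<le> mean Y (F k p)"
      unfolding F_def by (intro mean_nonneg order.trans[OF zero_le_one power_count_ge_1])
    have W: "W = p * \<Prod>(small - {p})" unfolding W_def using p by (simp add: prod.remove)
    show "mean Y (F k p) \<le> (if p dvd k then 8 else 1)"
    proof (cases "p dvd k")
      case True
      have "coprime q p" if "q \<in> small - {p}" for q
        using that p by (auto simp: small_def primes_coprime)
      then have "coprime (\<Prod>(small - {p})) p" by (intro prod_coprime_left)
      moreover have "p ^ z dvd Y"
        using dvd p finite_small by (meson dvd_prodI dvd_trans)
      ultimately show ?thesis
        using mean_power_count_common[of p "\<Prod>(small - {p})" z Y k] p True Y_pos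
        by (simp add: W small_def F_def[abs_def])
    next
      case False
      then have "\<not> p dvd W * (m + 1) + k" for m
        by (subst dvd_add_right_iff) (simp_all add: W)
      then have "F k p = (\<lambda>_. 1)" unfolding F_def by (intro ext power_count_eq_1)
      then show ?thesis using False Y_pos by (simp add: mean_const)
    qed
  qed
  also have "\<dots> = 8 ^ card {p \<in> small. p dvd k}"
    by (simp add: prod.If_cases Int_def)
  also have "\<dots> = real ((2 ^ card {p \<in> small. p dvd k}) ^ 3)"
    by (simp add: power_mult[symmetric] mult.commute[of _ 3] power_mult[of 2 3, simplified])
  also have "\<dots> \<le> real (k ^ 3)"
    using assms by (subst of_nat_le_iff) (intro power_mono card_prime_divisors_le, auto simp: small_def)
  finally show ?thesis by simp
qed

text \<open>The Euler product majorant splits into independent parts: small primes cost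
  \<open>k ^ 3\<close>, sieved blocks a convergent product, and each of the at most
  \<open>log 2 k\<close> unsieved blocks a factor \<open>exp 25\<close>.\<close>

lemma mean_\<nu>_weighted_divisors:
  assumes "k \<ge> 1"
  shows "mean Y (\<lambda>m. \<nu> m * weighted_divisors z (W * (m + 1) + k)) \<le>
    3 * real k powr (3 + 25 / ln 2) * mean Y \<nu>"
proof -
  let ?Q = "\<lambda>s m. U s m * (\<Prod>p\<in>block s. F k p m)"
  let ?e = "\<lambda>s. exp ((1 / 2) ^ (S - s) + 25 * of_bool (2 ^ (S - s) < k)) :: real"
  have perQ: "periodic (\<Prod>p\<in>block s. p ^ z) (?Q s)" for s
  proof (intro periodic_mult periodic_U periodic_prod)
    fix p assume "p \<in> block s"
    then show "periodic (\<Prod>p\<in>block s. p ^ z) (F k p)"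
      by (intro periodic_dvd[OF periodic_F] dvd_prodI) auto
  qed
  have nn: "mean Y (U s) \<ge> 0" for s by (intro mean_nonneg U_nonneg)
  have F_ge: "F k p m \<ge> 0" for p m
    unfolding F_def by (rule order.trans[OF zero_le_one power_count_ge_1])
  have "mean Y (\<lambda>m. \<nu> m * weighted_divisors z (W * (m + 1) + k)) \<le>
      mean Y (\<lambda>m. (\<Prod>p\<in>small. F k p m) * (\<Prod>s\<in>scales. ?Q s m))"
  proof (rule mean_mono)
    fix m
    have "\<nu> m * weighted_divisors z (W * (m + 1) + k) \<le> \<nu> m * (\<Prod>p\<in>primes. F k p m)"
      unfolding primes_def F_def by (intro mult_left_mono weighted_divisors_le \<nu>_nonneg)
    also have "\<dots> = (\<Prod>p\<in>small. F k p m) * (\<Prod>s\<in>scales. ?Q s m)"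
      unfolding prod_primes prod.distrib \<nu>_def by (simp only: mult_ac)
    finally show "\<nu> m * weighted_divisors z (W * (m + 1) + k) \<le> \<dots>" .
  qed
  also have "\<dots> = mean Y (\<lambda>m. \<Prod>p\<in>small. F k p m) * mean Y (\<lambda>m. \<Prod>s\<in>scales. ?Q s m)"
  proof (rule mean_mult_coprime[OF _ _ coprime_small_blocks period_dvd_Y Y_pos])
    show "periodic (\<Prod>p\<in>small. p ^ z) (\<lambda>m. \<Prod>p\<in>small. F k p m)"
      by (intro periodic_prod periodic_dvd[OF periodic_F] dvd_prodI) auto
    show "periodic (\<Prod>s\<in>scales. \<Prod>p\<in>block s. p ^ z) (\<lambda>m. \<Prod>s\<in>scales. ?Q s m)"
      by (intro periodic_prod periodic_dvd[OF perQ] dvd_prodI) auto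
  qed
  also have "mean Y (\<lambda>m. \<Prod>s\<in>scales. ?Q s m) = (\<Prod>s\<in>scales. mean Y (?Q s))"
    by (rule mean_prod_scales[OF perQ])
  also have "mean Y (\<lambda>m. \<Prod>p\<in>small. F k p m) * (\<Prod>s\<in>scales. mean Y (?Q s)) \<le>
      real k ^ 3 * (\<Prod>s\<in>scales. ?e s * mean Y (U s))"
    using assms
    by (intro mult_mono mean_prod_small prod_mono conjI mean_U_block mean_nonneg prod_nonneg
        mult_nonneg_nonneg U_nonneg F_ge ballI) auto
  also have "\<dots> = real k ^ 3 * exp (\<Sum>s\<in>scales. (1 / 2) ^ (S - s) + 25 * of_bool (2 ^ (S - s) < k)) * mean Y \<nu>"
    by (simp add: prod.distrib exp_sum mean_\<nu>)
  also have "\<dots> \<le> real k ^ 3 * (3 * real k powr (25 / ln 2)) * mean Y \<nu>"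
  proof (intro mult_right_mono mult_left_mono mean_nonneg \<nu>_nonneg)
    have "(\<Sum>s\<in>scales. (1 / 2) ^ (S - s) + 25 * of_bool (2 ^ (S - s) < k)) \<le>
        (\<Sum>s<S. (1 / 2) ^ (S - s) + 25 * of_bool (2 ^ (S - s) < k) :: real)"
      by (intro sum_mono2) (auto simp: scales_def)
    also have "\<dots> = (\<Sum>i<S. (1 / 2) ^ Suc i) + 25 * (\<Sum>i<S. of_bool (2 ^ Suc i < k))"
      by (subst sum_reflect) (simp only: sum.distrib sum_distrib_left)
    also have "\<dots> \<le> 1 + 25 * log 2 (real k)"
      using sum_geometric_le[of "1 / 2" S] card_powers_less[OF assms, of S]
      by (intro add_mono mult_left_mono) simp_all
    finally have "exp (\<Sum>s\<in>scales. (1 / 2) ^ (S - s) + 25 * of_bool (2 ^ (S - s) < k)) \<le>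
        exp (1 + 25 * log 2 (real k))" by simp
    also have "\<dots> = exp 1 * real k powr (25 / ln 2)"
      using assms by (simp add: exp_add powr_def log_def)
    also have "\<dots> \<le> 3 * real k powr (25 / ln 2)" using exp_le by (intro mult_right_mono) auto
    finally show "exp (\<Sum>s\<in>scales. (1 / 2) ^ (S - s) + 25 * of_bool (2 ^ (S - s) < k)) \<le>
        3 * real k powr (25 / ln 2)" .
  qed simp
  also have "real k ^ 3 * (3 * real k powr (25 / ln 2)) = 3 * real k powr (3 + 25 / ln 2)"
    using assms by (simp add: powr_add powr_numeral)
  finally show ?thesis .
qed

end

lemma sum_block_le:
  fixes B :: "nat set"
  assumes "B \<subseteq> {2..n}" "n \<ge> 1"
  shows "1 + real (\<Sum>B) \<le> real (n ^ 2)"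
proof -
  have "\<Sum>B \<le> \<Sum>{2..n}" using assms by (intro sum_mono2) auto
  also have "\<dots> \<le> (\<Sum>i\<in>{2..n}. n)" by (intro sum_mono) auto
  also have "\<dots> = (n - 1) * n" by simp
  finally have "1 + \<Sum>B \<le> n ^ 2" using assms(2) by (cases n) (auto simp: power2_eq_square)
  then show ?thesis by (metis of_nat_1 of_nat_add of_nat_le_iff)
qed

lemma ln_2_ge_half: "1 / 2 \<le> ln (2::real)"
proof -
  have "ln (1 / 2) \<le> 1 / 2 - (1::real)" by (intro ln_le_minus_one) simp
  then show ?thesis by (simp add: ln_div)
qed

text \<open>The factor \<open>3 * 4 ^ 14\<close> is the loss in passing to a divisor at most
  \<open>z\<close>; the quotient by \<open>ln (3 / 2)\<close> solves
  \<open>(3 / 2) ^ r \<le> 24 * k powr (5 + 25 / ln 2)\<close> for \<open>r\<close>; the last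
  \<open>1 / ln 2\<close> pays for rounding.\<close>

definition omega_const :: real where
  "omega_const = 3 * 4 ^ 14 * ((ln 24 / ln 2 + (5 + 25 / ln 2)) / ln (3 / 2) + 1 / ln 2)"

lemma omega_const_ge: "3 / ln 2 \<le> omega_const"
proof -
  have "0 \<le> (ln 24 / ln 2 + (5 + 25 / ln 2)) / ln (3 / 2 :: real)"
    by (intro divide_nonneg_nonneg add_nonneg_nonneg) auto
  then have "3 * 4 ^ 14 * (1 / ln 2) \<le> omega_const"
    unfolding omega_const_def by (intro mult_left_mono) auto
  moreover have "3 / ln (2::real) \<le> 3 * 4 ^ 14 * (1 / ln 2)"
    by (simp add: divide_right_mono)
  ultimately show ?thesis by linarith
qed

section \<open>Level of the weight and transfer to the interval below \<open>M\<close>\<close>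

context sieve
begin

lemma primes_dvd_Y:
  assumes "p \<in> primes" shows "p dvd Y"
proof -
  have "p dvd p ^ z" by (rule dvd_power) (simp add: z_def)
  also have "p ^ z dvd (\<Prod>p\<in>primes. p ^ z)" using assms by (intro dvd_prodI) auto
  finally show ?thesis by (simp add: Y_def)
qed

text \<open>The weight is a product of \<open>120 * \<kappa> s\<close> factors linear in the hit
  count, each costing at most the square of the largest prime bound,
  \<open>2 ^ (8 * 4 ^ s)\<close>.\<close>

lemma approximable_U:
  assumes "s \<in> scales"
  shows "approximable Y (U s) (2 ^ (960 * (4 ^ s * 2 ^ (S - s))))"
proof -
  let ?n = "2 ^ (4 * 4 ^ s) :: nat"
  let ?h = "\<lambda>p m. of_bool (hits W (\<kappa> s) p m) :: real"
  have hit: "approximable Y (?h p) (real p)" if "p \<in> block s" for p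
  proof -
    have "p dvd Y" using that assms primes_eq by (intro primes_dvd_Y) auto
    moreover have "periodic p (?h p)" using periodic_hits by (simp add: periodic_def)
    ultimately show ?thesis using approximable.base[of p Y "?h p" 1] by simp
  qed
  have sub: "block s \<subseteq> {2..?n}" by (auto simp: block_def prime_ge_2_nat)
  have factor: "approximable Y (\<lambda>m. 1 - real (hit_count W (\<kappa> s) (block s) m) / real l) (real (?n ^ 2))"
    if "l \<in> {1..120 * \<kappa> s}" for l
  proof -
    have "approximable Y (\<lambda>m. 1 + (- 1 / real l) * (\<Sum>p\<in>block s. ?h p m))
        (\<bar>1\<bar> + \<bar>- 1 / real l\<bar> * (\<Sum>p\<in>block s. real p))"
      by (intro approximable.add approximable_mult approximable_const approximable_sum hit finite_block)
    moreover have "\<bar>1\<bar> + \<bar>- 1 / real l\<bar> * (\<Sum>p\<in>block s. real p) \<le> 1 + 1 * (\<Sum>p\<in>block s. real p)"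
      using that by (intro add_mono mult_right_mono sum_nonneg) auto
    moreover have "1 + 1 * (\<Sum>p\<in>block s. real p) \<le> real (?n ^ 2)"
      using sum_block_le[OF sub] by simp
    ultimately have "approximable Y (\<lambda>m. 1 + (- 1 / real l) * (\<Sum>p\<in>block s. ?h p m)) (real (?n ^ 2))"
      by (meson approximable.mono)
    then show ?thesis by (simp add: hit_count_altdef)
  qed
  have "approximable Y (\<lambda>m. \<Prod>l\<in>{1..120 * \<kappa> s}. 1 - real (hit_count W (\<kappa> s) (block s) m) / real l)
      (\<Prod>l\<in>{1..120 * \<kappa> s}. real (?n ^ 2))"
    by (intro approximable_prod factor) auto
  moreover have "(\<Prod>l\<in>{1..120 * \<kappa> s}. real (?n ^ 2)) = 2 ^ (960 * (4 ^ s * 2 ^ (S - s)))"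
    by (simp add: \<kappa>_def power_mult[symmetric] mult_ac)
  ultimately show ?thesis by (simp add: U_def[abs_def] brun_def)
qed

text \<open>As \<open>4 ^ s * 2 ^ (S - s) = 2 ^ S * 2 ^ s\<close>, the exponents grow geometrically
  in \<open>s\<close> and the top scale dominates. The resulting level is the 16th root of
  \<open>M\<close>.\<close>

lemma approximable_\<nu>: "approximable Y \<nu> (2 ^ (2 ^ (2 * S - 4)))"
proof -
  have "approximable Y \<nu> (\<Prod>s\<in>scales. 2 ^ (960 * (4 ^ s * 2 ^ (S - s))))"
    unfolding \<nu>_def[abs_def] by (intro approximable_prod approximable_U) auto
  moreover have "(\<Prod>s\<in>scales. (2::real) ^ (960 * (4 ^ s * 2 ^ (S - s)))) \<le> 2 ^ (2 ^ (2 * S - 4))"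
  proof -
    have "(\<Sum>s\<in>scales. 960 * (4 ^ s * 2 ^ (S - s))) = 960 * (2 ^ S * (\<Sum>s\<in>scales. (2::nat) ^ s))"
      unfolding sum_distrib_left
    proof (intro sum.cong refl)
      fix s assume "s \<in> scales"
      then have "s + (S - s) = S" by (auto simp: scales_def)
      then have "(2::nat) ^ S = 2 ^ s * 2 ^ (S - s)" by (metis power_add)
      moreover have "(4::nat) ^ s = 2 ^ s * 2 ^ s" by (simp flip: power_mult_distrib)
      ultimately show "960 * (4 ^ s * 2 ^ (S - s)) = 960 * (2 ^ S * (2::nat) ^ s)" by simp
    qed
    also have "\<dots> \<le> 2 ^ 10 * (2 ^ S * 2 ^ (S - 14))"
    proof (intro mult_mono)
      have "(\<Sum>s\<in>scales. (2::nat) ^ s) \<le> (\<Sum>s<S - 14. 2 ^ s)"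
        by (intro sum_mono2) (auto simp: scales_def)
      then show "(\<Sum>s\<in>scales. (2::nat) ^ s) \<le> 2 ^ (S - 14)"
        using sum_powers_lessThan[of "S - 14"] by linarith
    qed auto
    also have "\<dots> = 2 ^ (2 * S - 4)"
      using S_ge unfolding power_add[symmetric] by (intro arg_cong[of _ _ "\<lambda>x. 2 ^ x"]) linarith
    finally have "(2::real) ^ (\<Sum>s\<in>scales. 960 * (4 ^ s * 2 ^ (S - s))) \<le> 2 ^ (2 ^ (2 * S - 4))"
      by (intro power_increasing) auto
    then show ?thesis by (simp only: power_sum)
  qed
  ultimately show ?thesis by (rule approximable.mono)
qed

lemma approximable_weighted_divisors:
  "approximable Y (\<lambda>m. weighted_divisors z (W * (m + 1) + k)) (2 ^ (3 * 4 ^ (S - 14)))"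
proof -
  have "approximable Y (\<lambda>m. weighted_divisors z (W * (m + 1) + k))
      (\<Sum>d\<in>{1..z}. \<bar>(3 / 2) ^ size (prime_factorization d)\<bar> * real d)"
    unfolding weighted_divisors_def
  proof (intro approximable_sum approximable.base)
    fix d assume d: "d \<in> {1..z}"
    then have "d dvd fact z" by (intro dvd_fact) auto
    then show "d dvd Y" by (simp add: Y_def)
    show "periodic d (\<lambda>m. of_bool (d dvd W * (m + 1) + k) :: real)"
      using periodic_dvd_linear[of d W k] by (simp only: periodic_def simp_thms)
  qed auto
  moreover have "(\<Sum>d\<in>{1..z}. \<bar>(3 / 2) ^ size (prime_factorization d)\<bar> * real d) \<le> 2 ^ (3 * 4 ^ (S - 14))"
  proof -
    have "\<bar>(3 / 2) ^ size (prime_factorization d)\<bar> * real d \<le> real z * real z" if "d \<in> {1..z}" for d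
    proof (intro mult_mono)
      have "(3 / 2 :: real) ^ size (prime_factorization d) \<le> real (2 ^ size (prime_factorization d))"
        by (simp add: power_mono)
      also have "\<dots> \<le> real z"
        using that size_prime_factorization_le[of d] by (intro iffD2[OF of_nat_le_iff]) auto
      finally show "\<bar>(3 / 2) ^ size (prime_factorization d)\<bar> \<le> real z" by simp
    qed (use that in auto)
    then have "(\<Sum>d\<in>{1..z}. \<bar>(3 / 2) ^ size (prime_factorization d)\<bar> * real d) \<le> real (card {1..z}) * (real z * real z)"
      by (intro sum_bounded_above)
    also have "\<dots> = real z ^ 3" by (simp add: power3_eq_cube)
    also have "\<dots> = 2 ^ (3 * 4 ^ (S - 14))"
      by (simp add: z_def power_mult[symmetric] mult.commute)
    finally show ?thesis .
  qed
  ultimately show ?thesis by (rule approximable.mono)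
qed

text \<open>Each block keeps at least \<open>exp (- 8 * \<kappa> s)\<close>, and the
  \<open>\<kappa> s\<close> sum to less than \<open>2 ^ (S + 1)\<close>. The loss is exponential
  only in the square root of \<open>4 ^ S\<close>, the binary logarithm of \<open>M\<close>.\<close>

lemma mean_\<nu>_lower: "2 powr (- (2 ^ (S + 5))) \<le> mean Y \<nu>"
proof -
  have "real (\<Sum>s\<in>scales. 16 * 2 ^ (S - s)) \<le> 2 ^ (S + 5)"
  proof -
    have "(\<Sum>s\<in>scales. 16 * 2 ^ (S - s)) \<le> (\<Sum>s<S. 16 * (2::nat) ^ (S - s))"
      by (intro sum_mono2) (auto simp: scales_def)
    also have "\<dots> = 32 * (\<Sum>i<S. 2 ^ i)"
      by (subst sum_reflect) (simp add: sum_distrib_left)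
    also have "\<dots> \<le> 32 * 2 ^ S" using sum_powers_lessThan[of S] by (intro mult_left_mono) auto
    also have "\<dots> = 2 ^ (S + 5)" by (simp add: power_add)
    finally have "real (\<Sum>s\<in>scales. 16 * 2 ^ (S - s)) \<le> real (2 ^ (S + 5))"
      by (rule iffD2[OF of_nat_le_iff])
    then show ?thesis by simp
  qed
  then have "(2::real) powr (- (2 ^ (S + 5))) \<le> 2 powr (- real (\<Sum>s\<in>scales. 16 * 2 ^ (S - s)))"
    by (intro powr_mono) auto
  also have "\<dots> = (\<Prod>s\<in>scales. 2 powr (- 16 * real (\<kappa> s)))"
    by (simp add: powr_sum[symmetric] sum_negf[symmetric] \<kappa>_def)
  also have "\<dots> \<le> (\<Prod>s\<in>scales. mean Y (U s))"
  proof (intro prod_mono conjI)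
    fix s assume "s \<in> scales"
    then interpret prime_block "block s" W "\<kappa> s" z Y by (rule prime_block_scale)
    have "(1::real) \<le> 2 * ln 2" using ln_2_ge_half by simp
    then have "8 * real (\<kappa> s) * 1 \<le> 8 * real (\<kappa> s) * (2 * ln 2)" by (intro mult_left_mono) auto
    then have "2 powr (- 16 * real (\<kappa> s)) \<le> exp (- 8 * real (\<kappa> s))"
      by (simp add: powr_def)
    also have "\<dots> \<le> mean Y (\<lambda>m. brun D (hit_count W (\<kappa> s) (block s) m))"
      using P0_lower mean_brun_lower by (rule order.trans)
    also have "\<dots> = mean Y (U s)" by (simp only: U_def[abs_def] D_def)
    finally show "2 powr (- 16 * real (\<kappa> s)) \<le> mean Y (U s)" .
  qed simp
  finally show ?thesis by (simp add: mean_\<nu>)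
qed

lemma M_pos: "M > 0"
  by (simp add: M_def)

text \<open>A cost up to the 8th root of \<open>M\<close> leaves an error far below the lower bound
  for \<open>mean Y \<nu>\<close>.\<close>

lemma error_le:
  assumes "c \<le> 2 ^ (2 ^ (2 * S - 3))"
  shows "2 * c / real M \<le> mean Y \<nu> / 2"
proof -
  have "(4::real) ^ S = 2 ^ (2 * S)" by (simp add: power_mult)
  also have "\<dots> = 8 * 2 ^ (2 * S - 3)"
    using S_ge power_add[of "2::real" 3 "2 * S - 3"] by simp
  finally have 4: "(4::real) ^ S = 8 * 2 ^ (2 * S - 3)" .
  have 5: "(2::real) ^ (S + 5) \<le> 2 ^ (2 * S - 3)" using S_ge by (intro power_increasing) auto
  have 6: "(2::real) \<le> 2 ^ (2 * S - 3)" using S_ge power_increasing[of 1 "2 * S - 3" "2::real"] by simp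
  have "4 * c \<le> 2 powr 2 * 2 powr (2 ^ (2 * S - 3))"
    using assms by (simp add: powr_numeral powr_realpow[symmetric] of_nat_power)
  also have "\<dots> \<le> 2 powr (4 ^ S) * 2 powr (- (2 ^ (S + 5)))"
    unfolding powr_add[symmetric] using 4 5 6 by (intro powr_mono) linarith+
  also have "\<dots> \<le> 2 powr (4 ^ S) * mean Y \<nu>"
    using mean_\<nu>_lower by (intro mult_left_mono) auto
  also have "(2::real) powr (4 ^ S) = real M"
    using powr_realpow[of 2 "4 ^ S"] by (simp add: M_def)
  finally show ?thesis using M_pos by (simp add: field_simps)
qed

lemma mean_M_\<nu>: "mean Y \<nu> \<le> 2 * mean M \<nu>" "mean Y \<nu> > 0"
proof -
  have "(2::real) ^ (2 ^ (2 * S - 4)) \<le> 2 ^ (2 ^ (2 * S - 3))"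
    by (intro power_increasing) auto
  then show "mean Y \<nu> \<le> 2 * mean M \<nu>"
    using approximable_mean[OF approximable_\<nu> Y_pos M_pos] error_le by fastforce
  show "mean Y \<nu> > 0" by (rule less_le_trans[OF _ mean_\<nu>_lower]) simp
qed

lemma mean_M_\<nu>_weighted_divisors:
  assumes "k \<ge> 1"
  shows "mean M (\<lambda>m. \<nu> m * weighted_divisors z (W * (m + 1) + k)) \<le>
    8 * real k powr (3 + 25 / ln 2) * mean M \<nu>"
proof -
  let ?b = "3 + 25 / ln 2 :: real"
  \<comment> \<open>Costs multiply, so exponents add; the divisor sum adds only
    \<open>3 * 2 ^ (2 * S - 28)\<close>.\<close>
  have "(2::nat) ^ (2 * S - 4) + 3 * 4 ^ (S - 14) \<le> 2 ^ (2 * S - 3)"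
  proof -
    have "(4::nat) ^ (S - 14) = 2 ^ (2 * S - 28)" 
      using power_mult[of "2::nat" 2 "S - 14"] by (simp add: right_diff_distrib')
    moreover have "(2::nat) ^ (2 * S - 28) * 2 ^ 24 = 2 ^ (2 * S - 4)"
      using S_ge unfolding power_add[symmetric] by (intro arg_cong[of _ _ "\<lambda>x. 2 ^ x"]) linarith
    moreover have "(2::nat) ^ (2 * S - 4) * 2 ^ 1 = 2 ^ (2 * S - 3)"
      using S_ge unfolding power_add[symmetric] by (intro arg_cong[of _ _ "\<lambda>x. 2 ^ x"]) linarith
    ultimately show ?thesis by simp
  qed
  then have "(2::real) ^ (2 ^ (2 * S - 4)) * 2 ^ (3 * 4 ^ (S - 14)) \<le> 2 ^ (2 ^ (2 * S - 3))"
    unfolding power_add[symmetric] by (intro power_increasing) auto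
  from error_le[OF this] approximable_mean[OF approximable_mult[OF approximable_\<nu> approximable_weighted_divisors[of k]] Y_pos M_pos]
  have "mean M (\<lambda>m. \<nu> m * weighted_divisors z (W * (m + 1) + k)) \<le>
      mean Y (\<lambda>m. \<nu> m * weighted_divisors z (W * (m + 1) + k)) + mean Y \<nu> / 2"
    by linarith
  also have "\<dots> \<le> 3 * real k powr ?b * mean Y \<nu> + real k powr ?b * mean Y \<nu>"
  proof (intro add_mono mean_\<nu>_weighted_divisors[OF assms])
    have "1 \<le> real k powr ?b" using assms by (intro ge_one_powr_ge_zero) auto
    then show "mean Y \<nu> / 2 \<le> real k powr ?b * mean Y \<nu>"
      using mult_right_mono[of 1 "real k powr ?b" "mean Y \<nu>"] mean_M_\<nu>(2) by linarith
  qed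
  also have "\<dots> = 4 * real k powr ?b * mean Y \<nu>" by simp
  also have "\<dots> \<le> 4 * real k powr ?b * (2 * mean M \<nu>)"
    using mean_M_\<nu>(1) by (intro mult_left_mono) auto
  finally show ?thesis by simp
qed

lemma ex_shift:
  "\<exists>m<M. \<forall>k\<in>{1..M}. weighted_divisors z (W * (m + 1) + k) \<le> 24 * real k powr (5 + 25 / ln 2)"
proof -
  have "\<exists>m<M. \<forall>k\<in>{1..M}. weighted_divisors z (W * (m + 1) + k) \<le> 3 * 8 * real k powr ((3 + 25 / ln 2) + 2)"
  proof (rule ex_small_values)
    show "mean M \<nu> > 0" using mean_M_\<nu> by linarith
    show "weighted_divisors z (W * (m + 1) + k) \<ge> 0" for k m
      unfolding weighted_divisors_def by (intro sum_nonneg) auto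
  qed (use mean_M_\<nu>_weighted_divisors \<nu>_nonneg in auto)
  then show ?thesis by (simp add: add.commute)
qed

section \<open>From small divisors to the number of prime factors\<close>

lemma W_le_M: "W \<le> M"
proof -
  have "W \<le> (\<Prod>p\<in>small. 2 ^ (4 ^ u))" unfolding W_def by (intro prod_mono) (auto simp: small_def)
  also have "\<dots> = (2 ^ (4 ^ u)) ^ card small" by simp
  also have "\<dots> \<le> (2 ^ (4 ^ u)) ^ (2 ^ (4 ^ u))"
  proof (intro power_increasing)
    have "small \<subseteq> {1..2 ^ (4 ^ u)}" by (auto simp: small_def prime_gt_0_nat Suc_le_eq)
    from card_mono[OF _ this] show "card small \<le> 2 ^ (4 ^ u)" by simp
  qed simp
  also have "\<dots> = 2 ^ (S * 2 ^ S)" by (simp add: S_def power_mult)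
  also have "\<dots> \<le> M"
    unfolding M_def
  proof (intro power_increasing)
    have "S * 2 ^ S \<le> 2 ^ S * 2 ^ S" by (intro mult_right_mono) (auto intro: less_imp_le)
    also have "\<dots> = 4 ^ S" by (simp flip: power_mult_distrib)
    finally show "S * 2 ^ S \<le> 4 ^ S" .
  qed simp
  finally show ?thesis .
qed

text \<open>A divisor \<open>d \<le> z\<close> carrying about a fraction \<open>1 / h\<close> of the
  prime factors contributes \<open>(3 / 2) ^ r\<close> to the divisor sum, so the bound on that sum
  limits \<open>r\<close>.\<close>

lemma size_le_near_shift:
  assumes "k \<in> {2..M}" "m < M"
    and "weighted_divisors z (W * (m + 1) + k) \<le> 24 * real k powr (5 + 25 / ln 2)"
  shows "real (size (prime_factorization (W * (m + 1) + k))) \<le> omega_const * ln (real k)"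
proof -
  define N where "N = W * (m + 1) + k"
  \<comment> \<open>Chosen so that \<open>z ^ h = M ^ 3\<close> bounds \<open>N\<close>; then
    \<open>d ^ h \<le> N\<close> forces \<open>d \<le> z\<close>.\<close>
  define h where "h = 3 * (4::nat) ^ 14"
  define r where "r = size (prime_factorization N) div h"
  let ?b = "5 + 25 / ln 2 :: real"
  let ?c = "(ln 24 / ln 2 + ?b) / ln (3 / 2) :: real"
  have N_pos: "N > 0" using assms by (simp add: N_def)
  have h_pos: "h > 0" by (simp add: h_def)
  have "h * r \<le> size (prime_factorization N)" unfolding r_def by simp
  then obtain d where d: "d dvd N" "size (prime_factorization d) = r" "d ^ h \<le> N"
    using ex_small_divisor_size[OF N_pos h_pos] by blast
  have "N \<le> M * M + M"
    unfolding N_def using assms W_le_M by (intro add_mono mult_mono) auto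
  also have "\<dots> \<le> M ^ 3"
  proof -
    have "M \<ge> 2" using assms(1) by simp
    then have "M \<le> M * M" "M * M * 2 \<le> M * M * M" by simp_all
    then show ?thesis by (simp only: power3_eq_cube)
  qed
  also have "\<dots> = z ^ h"
  proof -
    have "S = (S - 14) + 14" using S_ge by simp
    then have "(4::nat) ^ S = 4 ^ (S - 14) * 4 ^ 14" by (metis power_add)
    then have "4 ^ S * 3 = 4 ^ (S - 14) * h" by (simp only: h_def mult_ac)
    then show ?thesis unfolding M_def z_def by (simp only: power_mult[symmetric])
  qed
  finally have "d ^ h \<le> z ^ h" using d(3) by linarith
  then have "d \<le> z" using h_pos by (simp add: power_mono_iff)
  moreover have "d > 0" using d(1) N_pos by (auto intro!: gr0I)
  ultimately have "(3 / 2) ^ size (prime_factorization d) * of_bool (d dvd N) \<le> weighted_divisors z N"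
    unfolding weighted_divisors_def by (intro member_le_sum) auto
  then have "(3 / 2) ^ r \<le> 24 * real k powr ?b"
    using d assms(3) by (simp add: N_def)
  then have "ln ((3 / 2 :: real) ^ r) \<le> ln (24 * real k powr ?b)"
    using assms(1) by (subst ln_le_cancel_iff) auto
  then have "real r * ln (3 / 2) \<le> ln 24 + ?b * ln (real k)"
    using assms(1) by (simp add: ln_mult ln_powr ln_realpow)
  moreover have lnk: "ln 2 \<le> ln (real k)" using assms(1) by simp
  \<comment> \<open>Since \<open>k \<ge> 2\<close>, additive constants can be absorbed into
    multiples of \<open>ln k\<close>.\<close>
  then have "ln 24 / ln 2 * ln 2 \<le> ln 24 / ln 2 * ln (real k)" by (intro mult_left_mono) auto
  ultimately have "real r * ln (3 / 2) \<le> (ln 24 / ln 2 + ?b) * ln (real k)"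
    by (simp add: distrib_right)
  then have r: "real r \<le> ?c * ln (real k)" by (simp add: field_simps)
  have "size (prime_factorization N) \<le> h * (r + 1)"
    unfolding r_def using h_pos by (simp add: less_imp_le dividend_less_times_div)
  then have "real (size (prime_factorization N)) \<le> real h * (real r + 1)"
    by (metis of_nat_1 of_nat_add of_nat_le_iff of_nat_mult)
  also have "\<dots> \<le> real h * (?c * ln (real k) + 1 / ln 2 * ln (real k))"
    using r lnk by (intro mult_left_mono add_mono) auto
  also have "\<dots> = omega_const * ln (real k)"
    by (simp add: omega_const_def h_def distrib_right)
  finally show ?thesis by (simp add: N_def)
qed

text \<open>Beyond \<open>M\<close> the shift dominates: \<open>W * (m + 1) + k \<le> k ^ 3\<close>,
  and every prime factor is at least 2.\<close>

lemma size_le_far_shift: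
  assumes "M < k" "m < M"
  shows "real (size (prime_factorization (W * (m + 1) + k))) \<le> omega_const * ln (real k)"
proof -
  have k: "k \<ge> 2" using assms M_pos by linarith
  have "W * (m + 1) + k \<le> k * k + k"
    using assms W_le_M by (intro add_mono mult_mono) auto
  also have "\<dots> \<le> k ^ 3"
  proof -
    have "k \<le> k * k" "k * k * 2 \<le> k * k * k" using k by simp_all
    then show ?thesis by (simp only: power3_eq_cube)
  qed
  finally have "2 ^ size (prime_factorization (W * (m + 1) + k)) \<le> k ^ 3"
    using size_prime_factorization_le[of "W * (m + 1) + k"] k by simp
  then have "real (2 ^ size (prime_factorization (W * (m + 1) + k))) \<le> real (k ^ 3)"
    by (simp only: of_nat_le_iff)
  then have "ln ((2::real) ^ size (prime_factorization (W * (m + 1) + k))) \<le> ln (real k ^ 3)"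
    using k by (subst ln_le_cancel_iff) auto
  then have "real (size (prime_factorization (W * (m + 1) + k))) * ln 2 \<le> 3 * ln (real k)"
    using k by (simp add: ln_realpow)
  then have "real (size (prime_factorization (W * (m + 1) + k))) \<le> 3 / ln 2 * ln (real k)"
    by (simp add: field_simps)
  also have "\<dots> \<le> omega_const * ln (real k)"
    using k omega_const_ge by (intro mult_right_mono) auto
  finally show ?thesis .
qed

text \<open>Divisibility by \<open>W\<close> is recorded because it forces \<open>n\<close> to be
  large, which later yields infinitely many \<open>n\<close>.\<close>

lemma ex_good_number:
  "\<exists>n>0. W dvd n \<and> (\<forall>k\<ge>2. real (size (prime_factorization (n + k))) \<le> omega_const * ln (real k))"
proof -
  obtain m where m: "m < M"
    "\<And>k. k \<in> {1..M} \<Longrightarrow> weighted_divisors z (W * (m + 1) + k) \<le> 24 * real k powr (5 + 25 / ln 2)"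
    using ex_shift by blast
  have "real (size (prime_factorization (W * (m + 1) + k))) \<le> omega_const * ln (real k)"
    if "k \<ge> 2" for k
    using size_le_near_shift[of k m] size_le_far_shift[of k m] m that by (cases "k \<le> M") auto
  then show ?thesis using W_pos by (intro exI[of _ "W * (m + 1)"]) auto
qed

end

section \<open>Infinitely many good numbers\<close>

lemma little_omega_le_big_omega: "m > 0 \<Longrightarrow> little_omega m \<le> big_omega m"
  unfolding little_omega_eq_card_prime_factors big_omega_eq_size_prime_factorization
  by (simp add: size_multiset_overloaded_eq card_eq_sum del: sum_constant card_eq_sum[symmetric])
    (intro sum_mono, simp add: Suc_le_eq)

theorem theorem1:
  shows "\<exists>C::real. C > 0 \<and>
    infinite {n::nat. n > 0 \<and> (\<forall>k::nat. k \<ge> 2 \<longrightarrow>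
      little_omega (n + k) \<le> big_omega (n + k) \<and>
      real (big_omega (n + k)) \<le> C * ln (real k))}"
proof (intro exI conjI)
  have "0 < 3 / ln (2::real)" by simp
  then show "omega_const > 0" using omega_const_ge by linarith
  show "infinite {n::nat. n > 0 \<and> (\<forall>k::nat. k \<ge> 2 \<longrightarrow>
      little_omega (n + k) \<le> big_omega (n + k) \<and>
      real (big_omega (n + k)) \<le> omega_const * ln (real k))}" (is "infinite ?A")
    unfolding infinite_nat_iff_unbounded
  proof
    fix b :: nat
    obtain p where p: "prime p" "p > b" using bigger_prime by blast
    \<comment> \<open>The parameter is large enough for \<open>p\<close> to be a small prime, so
      \<open>p\<close> divides \<open>W\<close> and \<open>n \<ge> p > b\<close>; the summand 3
      secures \<open>u \<ge> 3\<close>.\<close>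
    interpret sieve "p + 3" by unfold_locales simp
    have "p + 3 < 2 ^ (p + 3)" by (rule less_exp)
    also have "(2::nat) ^ (p + 3) \<le> 4 ^ (p + 3)" by (rule power_mono) auto
    finally have "p \<le> 4 ^ (p + 3)" by linarith
    also have "\<dots> \<le> 2 ^ (4 ^ (p + 3))" by (intro less_imp_le less_exp)
    finally have "p dvd W"
      unfolding W_def using p finite_small by (intro dvd_prodI) (auto simp: small_def)
    moreover obtain n where n: "n > 0" "W dvd n"
      "\<And>k. k \<ge> 2 \<Longrightarrow> real (size (prime_factorization (n + k))) \<le> omega_const * ln (real k)"
      using ex_good_number by blast
    ultimately have "n \<ge> p" by (meson dvd_imp_le dvd_trans)
    moreover have "n \<in> ?A"
    proof (intro CollectI conjI allI impI)
      fix k :: nat assume k: "k \<ge> 2"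
      show "little_omega (n + k) \<le> big_omega (n + k)"
        using n(1) by (intro little_omega_le_big_omega) simp
      show "real (big_omega (n + k)) \<le> omega_const * ln (real k)"
        using n k by (simp add: big_omega_eq_size_prime_factorization)
    qed (rule n(1))
    ultimately show "\<exists>n>b. n \<in> ?A" using p(2) by (meson less_le_trans)
  qed
qed

end
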